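(* Let $(\mathcal{C},\mathcal{D})$ be any one of the following seven pairs (a category of modal frames, a category of relational spaces): $(\mathbf{MFrm},\mathbf{RelSp})$, $(\mathbf{MFrm},\mathbf{RelSp}^{l})$, $(\mathbf{MFrm},\mathbf{RelSpq})$, $(\mathbf{MFrm}^{\Diamond},\mathbf{RelSpq}^{l})$, $(\mathbf{MFrm}^{\Box},\mathbf{RelSpq}^{u})$, $(\mathbf{MFrm}^{\Box\Diamond},\mathbf{RelSpq}^{c})$, $(\mathbf{EqFrm},\mathbf{EqSpq})$. Then there is a contravariant adjunction between $\mathcal{C}$ and $\mathcal{D}$: the assignment $A\mapsto \mathcal{F}(A)=(\mathbb{P}_A,\mathfrak{O}_A,R_A)$ (in the version of the point construction attached to $\mathcal{D}$) is the object part of a contravariant functor $\mathcal{F}:\mathcal{C}\to\mathcal{D}$ adjoint to the contravariant functor $\Omega:\mathcal{D}\to\mathcal{C}$, with unit on the modal frame side given by $\phi_A:A\to\Omega(\mathcal{F}(A))$. That is, $\mathcal{F}(A)$ is an object of $\mathcal{D}$ and $\phi_A$ a morphism of $\mathcal{C}$ for every object $A$ of $\mathcal{C}$, and for every object $X$ of $\mathcal{D}$ and every morphism $f:A\to\Omega X$ of $\mathcal{C}$ there is a unique morphism $g:X\to\mathcal{F}(A)$ of $\mathcal{D}$ with $\Omega(g)\circ\phi_A=f$.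
   Context: Relational spaces. A relational space $(X,\mathcal{O},R)$ is a topological space $(X,\mathcal{O})$ with an arbitrary binary relation $R\subseteq X\times X$. Write $R^{\rightarrow}(x)=\{x'\mid xRx'\}$. For $U\subseteq X$ put $\Box_R U=\{x\mid R^{\rightarrow}(x)\subseteq U\}$, $\Diamond_R U=\{x\mid R^{\rightarrow}(x)\cap U\neq\emptyset\}$. The space is upper-semicontinuous (u.s.c.) if $\Box_R U$ is open for all open $U$, lower-semicontinuous (l.s.c.) if $\Diamond_R U$ is open for all open $U$, continuous if both; it is an equivalence space if it is continuous and $R$ is an equivalence relation. A continuous function $f:(X,\mathcal{O},R)\to(Y,\mathcal{P},S)$ is a continuous p-morphism if (1) $xRx'\Rightarrow f(x)Sf(x')$ and (2) for all $U\in\mathcal{P}$, if $f(x)Sy$ and $y\in U$ then there is $x'$ with $xRx'$ and $f(x')\in U$. It is a continuous pq-morphism if moreover (3) for all $U\in\mathcal{P}$, if $f(x)Sy$ and $y\notin U$ then there is $x'$ with $xRx'$ and $f(x')\notin U$. Categories: $\mathbf{RelSp}$, $\mathbf{RelSp}^l$ have as objects all, resp. l.s.c., relational spaces, with continuous p-morphisms; $\mathbf{RelSpq}$, $\mathbf{RelSpq}^l$, $\mathbf{RelSpq}^u$, $\mathbf{RelSpq}^c$, $\mathbf{EqSpq}$ have as objects all, l.s.c., u.s.c., continuous relational spaces, resp. equivalence spaces, with continuous pq-morphisms. Modal frames. A modal frame $(A,\Box,\Diamond)$ is a frame $A$ with monotone maps $\Box,\Diamond:A\to A$ such that for all $a,b$: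 $\top\le\Box\top$; $\Box a\wedge\Box b\le\Box(a\wedge b)$; $\Box a\wedge\Diamond b\le\Diamond(a\wedge b)$; $\Diamond\bot\le\bot$. An equivalence frame is a modal frame with, for all $a$: $\Box a\le a$, $a\le\Diamond a$, $\Box a\le\Box\Box a$, $\Diamond\Diamond a\le\Diamond a$, $\Diamond\Box a\le a$, $a\le\Box\Diamond a$. A modal frame morphism is a frame morphism $f$ with $f(\Box a)\le\Box f(a)$ and $f(\Diamond a)\le\Diamond f(a)$ for all $a$; it is box-strict (diamond-strict) if the first (second) is always an equality, strict if both are. $\mathbf{MFrm}$, $\mathbf{MFrm}^{\Box}$, $\mathbf{MFrm}^{\Diamond}$, $\mathbf{MFrm}^{\Box\Diamond}$: modal frames with all, box-strict, diamond-strict, strict morphisms; $\mathbf{EqFrm}$: equivalence frames with strict morphisms. The functor $\Omega$. $\Omega(X,\mathcal{O},R)=(\mathcal{O},\Box,\Diamond)$ with $\Box U$, $\Diamond U$ the interiors of $\Box_R U$, $\Diamond_R U$; $\Omega f=f^{-1}$. (In some cases $\Omega$ lands in a proper subcategory of $\mathcal{C}$; it is regarded as a functor with codomain $\mathcal{C}$.) Point construction. Let $A$ be a modal frame. A frame character is a frame morphism $p:A\to\mathbf 2=\{0<1\}$; $\nabla(p)=\{a\mid p(a)=1\}$; $F_p=\{c\mid p(\Box c)=1\}$. Filters are nonempty up-closed subsets closed under binary meets (possibly all of $A$). Consider, for a frame character $p$, $a\in A$ and a filter $F\subseteq A$: (i) $p(\Diamond a)=0$; (ii) for all $c$, $p(\Diamond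 c)=0$ implies $c\le a$; (iii) $F_p\subseteq F$; (iv) $F\subseteq F_p$. Pre-points are: for $\mathbf{RelSp}$, pairs $(p,a)$ with (i); for $\mathbf{RelSp}^l$, pairs $(p,a)$ with (i),(ii); for $\mathbf{RelSpq}$, triples $(p,a,F)$ with (i),(iii); for $\mathbf{RelSpq}^l$, triples with (i),(ii),(iii); for $\mathbf{RelSpq}^u$, triples with (i),(iii),(iv); for $\mathbf{RelSpq}^c$ and $\mathbf{EqSpq}$, triples with (i)–(iv). Relation on pre-points: $(p,a)R_A(q,b)$ iff $q(a)=0$ and $p(\Box c)\le q(c)$ for all $c$; $(p,a,F)R_A(q,b,G)$ iff $q(a)=0$ and $F\subseteq\nabla(q)$. The set $\mathbb{P}_A$ of (modal frame) points is the largest set of pre-points such that: (D) for each point with first components $p,a$ and each $c\not\le a$ there is an $R_A$-related point with first component $q$ such that $q(c)=1$; and, in the triple versions only, also (B) for each point $(p,a,F)$ and each $c\notin F$ there is an $R_A$-related point with first component $q$ such that $q(c)=0$. Let $\phi_A(c)$ be the set of points whose first component $p$ has $p(c)=1$; the topology $\mathfrak{O}_A$ on $\mathbb{P}_A$ is $\{\phi_A(c)\mid c\in A\}$.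
   Formalization: The pair (MFrm, RelSp^l) is replaced by (MFrm^◇, RelSp^l): the original fails for A={0<1}, □=id, ◇=0 and X one reflexive point, and for l.s.c. spaces every map Ω(g)∘φ_A is diamond-strict, so only diamond-strict f can factor. *)

theory Defs
  imports "HOL-Analysis.Abstract_Topology" "HOL-Algebra.Complete_Lattice"
begin

section \<open>Modal frames\<close>

locale frame = complete_lattice L for L (structure) +
  assumes meet_sup_distrib:
    "\<lbrakk>a \<in> carrier L; S \<subseteq> carrier L\<rbrakk> \<Longrightarrow> a \<sqinter> (\<Squnion>S) = \<Squnion>((\<lambda>b. a \<sqinter> b) ` S)"

record 'a mframe = "'a gorder" +
  box :: "'a \<Rightarrow> 'a"
  dia :: "'a \<Rightarrow> 'a"

locale modal_frame = frame A for A :: "('a, 'm) mframe_scheme" (structure) +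
  assumes box_closed: "a \<in> carrier A \<Longrightarrow> box A a \<in> carrier A"
    and dia_closed: "a \<in> carrier A \<Longrightarrow> dia A a \<in> carrier A"
    and box_mono: "\<lbrakk>a \<in> carrier A; b \<in> carrier A; a \<sqsubseteq> b\<rbrakk> \<Longrightarrow> box A a \<sqsubseteq> box A b"
    and dia_mono: "\<lbrakk>a \<in> carrier A; b \<in> carrier A; a \<sqsubseteq> b\<rbrakk> \<Longrightarrow> dia A a \<sqsubseteq> dia A b"
    and box_top: "\<top> \<sqsubseteq> box A \<top>"
    and box_meet: "\<lbrakk>a \<in> carrier A; b \<in> carrier A\<rbrakk> \<Longrightarrow> box A a \<sqinter> box A b \<sqsubseteq> box A (a \<sqinter> b)"
    and box_dia: "\<lbrakk>a \<in> carrier A; b \<in> carrier A\<rbrakk> \<Longrightarrow> box A a \<sqinter> dia A b \<sqsubseteq> dia A (a \<sqinter> b)"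
    and dia_bottom: "dia A \<bottom> \<sqsubseteq> \<bottom>"

locale equivalence_frame = modal_frame A for A :: "('a, 'm) mframe_scheme" (structure) +
  assumes box_T: "a \<in> carrier A \<Longrightarrow> box A a \<sqsubseteq> a"
    and dia_T: "a \<in> carrier A \<Longrightarrow> a \<sqsubseteq> dia A a"
    and box_4: "a \<in> carrier A \<Longrightarrow> box A a \<sqsubseteq> box A (box A a)"
    and dia_4: "a \<in> carrier A \<Longrightarrow> dia A (dia A a) \<sqsubseteq> dia A a"
    and dia_box: "a \<in> carrier A \<Longrightarrow> dia A (box A a) \<sqsubseteq> a"
    and box_dia_B: "a \<in> carrier A \<Longrightarrow> a \<sqsubseteq> box A (dia A a)"

text \<open>Morphisms are extensional functions, so that HOL equality of morphisms is
  equality on the carrier; they compose by \<^const>\<open>compose\<close>.\<close>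

definition frame_hom :: "('a, 'm) gorder_scheme \<Rightarrow> ('b, 'n) gorder_scheme \<Rightarrow> ('a \<Rightarrow> 'b) set" where
  "frame_hom A B = {f \<in> carrier A \<rightarrow>\<^sub>E carrier B.
     f \<top>\<^bsub>A\<^esub> = \<top>\<^bsub>B\<^esub> \<and>
     (\<forall>a\<in>carrier A. \<forall>b\<in>carrier A. f (a \<sqinter>\<^bsub>A\<^esub> b) = f a \<sqinter>\<^bsub>B\<^esub> f b) \<and>
     (\<forall>S. S \<subseteq> carrier A \<longrightarrow> f (\<Squnion>\<^bsub>A\<^esub> S) = \<Squnion>\<^bsub>B\<^esub> (f ` S))}"

definition modal_frame_hom ::
  "('a, 'm) mframe_scheme \<Rightarrow> ('b, 'n) mframe_scheme \<Rightarrow> ('a \<Rightarrow> 'b) set" where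
  "modal_frame_hom A B = {f \<in> frame_hom A B.
     \<forall>a\<in>carrier A. f (box A a) \<sqsubseteq>\<^bsub>B\<^esub> box B (f a) \<and> f (dia A a) \<sqsubseteq>\<^bsub>B\<^esub> dia B (f a)}"

definition box_strict ::
  "('a, 'm) mframe_scheme \<Rightarrow> ('b, 'n) mframe_scheme \<Rightarrow> ('a \<Rightarrow> 'b) \<Rightarrow> bool" where
  "box_strict A B f \<longleftrightarrow> (\<forall>a\<in>carrier A. f (box A a) = box B (f a))"

definition dia_strict ::
  "('a, 'm) mframe_scheme \<Rightarrow> ('b, 'n) mframe_scheme \<Rightarrow> ('a \<Rightarrow> 'b) \<Rightarrow> bool" where
  "dia_strict A B f \<longleftrightarrow> (\<forall>a\<in>carrier A. f (dia A a) = dia B (f a))"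

datatype mframe_cat = MFrm | MFrm_box | MFrm_dia | MFrm_boxdia | EqFrm

fun mframe_Ob :: "mframe_cat \<Rightarrow> 'a mframe \<Rightarrow> bool" where
  "mframe_Ob EqFrm A = equivalence_frame A"
| "mframe_Ob _ A = modal_frame A"

fun mframe_Hom :: "mframe_cat \<Rightarrow> 'a mframe \<Rightarrow> 'b mframe \<Rightarrow> ('a \<Rightarrow> 'b) set" where
  "mframe_Hom MFrm A B = modal_frame_hom A B"
| "mframe_Hom MFrm_box A B = {f \<in> modal_frame_hom A B. box_strict A B f}"
| "mframe_Hom MFrm_dia A B = {f \<in> modal_frame_hom A B. dia_strict A B f}"
| "mframe_Hom MFrm_boxdia A B = {f \<in> modal_frame_hom A B. box_strict A B f \<and> dia_strict A B f}"
| "mframe_Hom EqFrm A B = {f \<in> modal_frame_hom A B. box_strict A B f \<and> dia_strict A B f}"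


section \<open>Relational spaces\<close>

record 'x relspace =
  opens :: "'x topology"
  rel :: "('x \<times> 'x) set"

abbreviation points :: "('x, 'm) relspace_scheme \<Rightarrow> 'x set" where
  "points X \<equiv> topspace (opens X)"

definition relational_space :: "'x relspace \<Rightarrow> bool" where
  "relational_space X \<longleftrightarrow> rel X \<subseteq> points X \<times> points X"

definition box_rel :: "'x relspace \<Rightarrow> 'x set \<Rightarrow> 'x set" where
  "box_rel X U = {x \<in> points X. rel X `` {x} \<subseteq> U}"

definition dia_rel :: "'x relspace \<Rightarrow> 'x set \<Rightarrow> 'x set" where
  "dia_rel X U = {x \<in> points X. rel X `` {x} \<inter> U \<noteq> {}}"

definition usc :: "'x relspace \<Rightarrow> bool" where
  "usc X \<longleftrightarrow> (\<forall>U. openin (opens X) U \<longrightarrow> openin (opens X) (box_rel X U))"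

definition lsc :: "'x relspace \<Rightarrow> bool" where
  "lsc X \<longleftrightarrow> (\<forall>U. openin (opens X) U \<longrightarrow> openin (opens X) (dia_rel X U))"

definition p_morphism :: "'x relspace \<Rightarrow> 'y relspace \<Rightarrow> ('x \<Rightarrow> 'y) \<Rightarrow> bool" where
  "p_morphism X Y f \<longleftrightarrow>
     f \<in> extensional (points X) \<and> continuous_map (opens X) (opens Y) f \<and>
     (\<forall>x x'. (x, x') \<in> rel X \<longrightarrow> (f x, f x') \<in> rel Y) \<and>
     (\<forall>U. openin (opens Y) U \<longrightarrow>
        (\<forall>x\<in>points X. \<forall>y. (f x, y) \<in> rel Y \<and> y \<in> U \<longrightarrow> (\<exists>x'. (x, x') \<in> rel X \<and> f x' \<in> U)))"

definition pq_morphism :: "'x relspace \<Rightarrow> 'y relspace \<Rightarrow> ('x \<Rightarrow> 'y) \<Rightarrow> bool" where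
  "pq_morphism X Y f \<longleftrightarrow> p_morphism X Y f \<and>
     (\<forall>U. openin (opens Y) U \<longrightarrow>
        (\<forall>x\<in>points X. \<forall>y. (f x, y) \<in> rel Y \<and> y \<notin> U \<longrightarrow> (\<exists>x'. (x, x') \<in> rel X \<and> f x' \<notin> U)))"

datatype relspace_cat = RelSp | RelSp_l | RelSpq | RelSpq_l | RelSpq_u | RelSpq_c | EqSpq

fun relspace_Ob :: "relspace_cat \<Rightarrow> 'x relspace \<Rightarrow> bool" where
  "relspace_Ob RelSp X \<longleftrightarrow> relational_space X"
| "relspace_Ob RelSp_l X \<longleftrightarrow> relational_space X \<and> lsc X"
| "relspace_Ob RelSpq X \<longleftrightarrow> relational_space X"
| "relspace_Ob RelSpq_l X \<longleftrightarrow> relational_space X \<and> lsc X"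
| "relspace_Ob RelSpq_u X \<longleftrightarrow> relational_space X \<and> usc X"
| "relspace_Ob RelSpq_c X \<longleftrightarrow> relational_space X \<and> usc X \<and> lsc X"
| "relspace_Ob EqSpq X \<longleftrightarrow> relational_space X \<and> usc X \<and> lsc X \<and> equiv (points X) (rel X)"

fun relspace_Hom :: "relspace_cat \<Rightarrow> 'x relspace \<Rightarrow> 'y relspace \<Rightarrow> ('x \<Rightarrow> 'y) set" where
  "relspace_Hom RelSp X Y = {f. p_morphism X Y f}"
| "relspace_Hom RelSp_l X Y = {f. p_morphism X Y f}"
| "relspace_Hom _ X Y = {f. pq_morphism X Y f}"


section \<open>The functor \<open>\<Omega>\<close>\<close>

definition Omega :: "'x relspace \<Rightarrow> 'x set mframe" where
  "Omega X = \<lparr>carrier = {U. openin (opens X) U}, eq = (=), le = (\<subseteq>),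
     box = (\<lambda>U. opens X interior_of (box_rel X U)),
     dia = (\<lambda>U. opens X interior_of (dia_rel X U))\<rparr>"

definition Omega_map :: "'x relspace \<Rightarrow> 'y relspace \<Rightarrow> ('x \<Rightarrow> 'y) \<Rightarrow> 'y set \<Rightarrow> 'x set" where
  "Omega_map X Y f = (\<lambda>V\<in>carrier (Omega Y). f -` V \<inter> points X)"


section \<open>The point construction\<close>

definition two :: "bool gorder" where
  "two = \<lparr>carrier = UNIV, eq = (=), le = (\<le>)\<rparr>"

definition frame_character :: "'a mframe \<Rightarrow> ('a \<Rightarrow> bool) \<Rightarrow> bool" where
  "frame_character A p \<longleftrightarrow> p \<in> frame_hom A two"

definition nabla :: "'a mframe \<Rightarrow> ('a \<Rightarrow> bool) \<Rightarrow> 'a set" where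
  "nabla A p = {a \<in> carrier A. p a}"

definition box_preimage :: "'a mframe \<Rightarrow> ('a \<Rightarrow> bool) \<Rightarrow> 'a set" where
  "box_preimage A p = {c \<in> carrier A. p (box A c)}"

definition lattice_filter :: "'a mframe \<Rightarrow> 'a set \<Rightarrow> bool" where
  "lattice_filter A F \<longleftrightarrow> F \<subseteq> carrier A \<and> F \<noteq> {} \<and>
     (\<forall>a\<in>F. \<forall>b\<in>carrier A. a \<sqsubseteq>\<^bsub>A\<^esub> b \<longrightarrow> b \<in> F) \<and>
     (\<forall>a\<in>F. \<forall>b\<in>F. a \<sqinter>\<^bsub>A\<^esub> b \<in> F)"

definition pre_i :: "'a mframe \<Rightarrow> ('a \<Rightarrow> bool) \<Rightarrow> 'a \<Rightarrow> bool" where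
  "pre_i A p a \<longleftrightarrow> \<not> p (dia A a)"

definition pre_ii :: "'a mframe \<Rightarrow> ('a \<Rightarrow> bool) \<Rightarrow> 'a \<Rightarrow> bool" where
  "pre_ii A p a \<longleftrightarrow> (\<forall>c\<in>carrier A. \<not> p (dia A c) \<longrightarrow> c \<sqsubseteq>\<^bsub>A\<^esub> a)"

definition pre_iii :: "'a mframe \<Rightarrow> ('a \<Rightarrow> bool) \<Rightarrow> 'a set \<Rightarrow> bool" where
  "pre_iii A p F \<longleftrightarrow> box_preimage A p \<subseteq> F"

definition pre_iv :: "'a mframe \<Rightarrow> ('a \<Rightarrow> bool) \<Rightarrow> 'a set \<Rightarrow> bool" where
  "pre_iv A p F \<longleftrightarrow> F \<subseteq> box_preimage A p"

type_synonym 'a pair_pt = "('a \<Rightarrow> bool) \<times> 'a"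
type_synonym 'a triple_pt = "('a \<Rightarrow> bool) \<times> 'a \<times> 'a set"

definition pre_RelSp :: "'a mframe \<Rightarrow> 'a pair_pt set" where
  "pre_RelSp A = {(p, a). frame_character A p \<and> a \<in> carrier A \<and> pre_i A p a}"

definition pre_RelSp_l :: "'a mframe \<Rightarrow> 'a pair_pt set" where
  "pre_RelSp_l A = {(p, a). frame_character A p \<and> a \<in> carrier A \<and> pre_i A p a \<and> pre_ii A p a}"

definition pre_RelSpq :: "'a mframe \<Rightarrow> 'a triple_pt set" where
  "pre_RelSpq A = {(p, a, F). frame_character A p \<and> a \<in> carrier A \<and> lattice_filter A F \<and>
     pre_i A p a \<and> pre_iii A p F}"

definition pre_RelSpq_l :: "'a mframe \<Rightarrow> 'a triple_pt set" where
  "pre_RelSpq_l A = {(p, a, F). frame_character A p \<and> a \<in> carrier A \<and> lattice_filter A F \<and>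
     pre_i A p a \<and> pre_ii A p a \<and> pre_iii A p F}"

definition pre_RelSpq_u :: "'a mframe \<Rightarrow> 'a triple_pt set" where
  "pre_RelSpq_u A = {(p, a, F). frame_character A p \<and> a \<in> carrier A \<and> lattice_filter A F \<and>
     pre_i A p a \<and> pre_iii A p F \<and> pre_iv A p F}"

definition pre_RelSpq_c :: "'a mframe \<Rightarrow> 'a triple_pt set" where
  "pre_RelSpq_c A = {(p, a, F). frame_character A p \<and> a \<in> carrier A \<and> lattice_filter A F \<and>
     pre_i A p a \<and> pre_ii A p a \<and> pre_iii A p F \<and> pre_iv A p F}"

definition pair_rel :: "'a mframe \<Rightarrow> ('a pair_pt \<times> 'a pair_pt) set" where
  "pair_rel A = {((p, a), (q, b)). \<not> q a \<and> (\<forall>c\<in>carrier A. p (box A c) \<longrightarrow> q c)}"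

definition triple_rel :: "'a mframe \<Rightarrow> ('a triple_pt \<times> 'a triple_pt) set" where
  "triple_rel A = {((p, a, F), (q, b, G)). \<not> q a \<and> F \<subseteq> nabla A q}"

definition pair_sat :: "'a mframe \<Rightarrow> 'a pair_pt set \<Rightarrow> bool" where
  "pair_sat A P \<longleftrightarrow>
     (\<forall>(p, a)\<in>P. \<forall>c\<in>carrier A. \<not> c \<sqsubseteq>\<^bsub>A\<^esub> a \<longrightarrow>
        (\<exists>(q, b)\<in>P. ((p, a), (q, b)) \<in> pair_rel A \<and> q c))"

definition triple_sat :: "'a mframe \<Rightarrow> 'a triple_pt set \<Rightarrow> bool" where
  "triple_sat A P \<longleftrightarrow>
     (\<forall>(p, a, F)\<in>P. \<forall>c\<in>carrier A. \<not> c \<sqsubseteq>\<^bsub>A\<^esub> a \<longrightarrow>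
        (\<exists>(q, b, G)\<in>P. ((p, a, F), (q, b, G)) \<in> triple_rel A \<and> q c)) \<and>
     (\<forall>(p, a, F)\<in>P. \<forall>c\<in>carrier A - F.
        (\<exists>(q, b, G)\<in>P. ((p, a, F), (q, b, G)) \<in> triple_rel A \<and> \<not> q c))"

definition pair_points :: "'a mframe \<Rightarrow> 'a pair_pt set \<Rightarrow> 'a pair_pt set" where
  "pair_points A Pre = \<Union>{P. P \<subseteq> Pre \<and> pair_sat A P}"

definition triple_points :: "'a mframe \<Rightarrow> 'a triple_pt set \<Rightarrow> 'a triple_pt set" where
  "triple_points A Pre = \<Union>{P. P \<subseteq> Pre \<and> triple_sat A P}"

text \<open>The unions are themselves saturated, hence the largest saturated sets of pre-points.\<close>

lemma pair_points_largest:
  shows "pair_points A Pre \<subseteq> Pre" "pair_sat A (pair_points A Pre)"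
    and "\<lbrakk>P \<subseteq> Pre; pair_sat A P\<rbrakk> \<Longrightarrow> P \<subseteq> pair_points A Pre"
proof -
  show "pair_points A Pre \<subseteq> Pre"
    by (auto simp: pair_points_def)
  show upper: "P \<subseteq> pair_points A Pre" if "P \<subseteq> Pre" "pair_sat A P" for P
    using that by (auto simp: pair_points_def)
  have D: "\<exists>(q, b)\<in>pair_points A Pre. ((p, a), (q, b)) \<in> pair_rel A \<and> q c"
    if "(p, a) \<in> pair_points A Pre" "c \<in> carrier A" "\<not> c \<sqsubseteq>\<^bsub>A\<^esub> a" for p a c
  proof -
    obtain P where P: "P \<subseteq> Pre" "pair_sat A P" "(p, a) \<in> P"
      using \<open>(p, a) \<in> _\<close> unfolding pair_points_def by auto
    then have "\<exists>(q, b)\<in>P. ((p, a), (q, b)) \<in> pair_rel A \<and> q c"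
      using that(2,3) unfolding pair_sat_def by (auto dest!: bspec)
    then show ?thesis
      by (rule bexE) (rule bexI, assumption, rule subsetD[OF upper[OF P(1,2)]])
  qed
  show "pair_sat A (pair_points A Pre)"
    unfolding pair_sat_def by (intro ballI case_prodI2 impI) (rule D; simp)
qed

lemma triple_points_largest:
  shows "triple_points A Pre \<subseteq> Pre" "triple_sat A (triple_points A Pre)"
    and "\<lbrakk>P \<subseteq> Pre; triple_sat A P\<rbrakk> \<Longrightarrow> P \<subseteq> triple_points A Pre"
proof -
  show "triple_points A Pre \<subseteq> Pre"
    by (auto simp: triple_points_def)
  show upper: "P \<subseteq> triple_points A Pre" if "P \<subseteq> Pre" "triple_sat A P" for P
    using that by (auto simp: triple_points_def)
  have mem: "\<exists>P. P \<subseteq> Pre \<and> triple_sat A P \<and> z \<in> P" if "z \<in> triple_points A Pre" for z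
    using that unfolding triple_points_def by simp
  have D: "\<exists>(q, b, G)\<in>triple_points A Pre. ((p, a, F), (q, b, G)) \<in> triple_rel A \<and> q c"
    if z: "(p, a, F) \<in> triple_points A Pre" and c: "c \<in> carrier A" "\<not> c \<sqsubseteq>\<^bsub>A\<^esub> a" for p a F c
  proof -
    obtain P where P: "P \<subseteq> Pre" "triple_sat A P" "(p, a, F) \<in> P"
      using mem[OF z] by blast
    then have "\<exists>(q, b, G)\<in>P. ((p, a, F), (q, b, G)) \<in> triple_rel A \<and> q c"
      using c unfolding triple_sat_def by (auto dest!: bspec)
    then show ?thesis
      by (rule bexE) (rule bexI, assumption, rule subsetD[OF upper[OF P(1,2)]])
  qed
  have B: "\<exists>(q, b, G)\<in>triple_points A Pre. ((p, a, F), (q, b, G)) \<in> triple_rel A \<and> \<not> q c"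
    if z: "(p, a, F) \<in> triple_points A Pre" and c: "c \<in> carrier A - F" for p a F c
  proof -
    obtain P where P: "P \<subseteq> Pre" "triple_sat A P" "(p, a, F) \<in> P"
      using mem[OF z] by blast
    then have "\<exists>(q, b, G)\<in>P. ((p, a, F), (q, b, G)) \<in> triple_rel A \<and> \<not> q c"
      using c unfolding triple_sat_def by (auto dest!: bspec)
    then show ?thesis
      by (rule bexE) (rule bexI, assumption, rule subsetD[OF upper[OF P(1,2)]])
  qed
  show "triple_sat A (triple_points A Pre)"
    unfolding triple_sat_def by (intro conjI ballI case_prodI2 impI) (rule D B; simp)+
qed

text \<open>In both versions the first component of a point \<open>z\<close> is \<open>fst z\<close>, so the following
  two definitions serve pairs and triples alike.\<close>

definition phi :: "'a mframe \<Rightarrow> (('a \<Rightarrow> bool) \<times> 'r) set \<Rightarrow> 'a \<Rightarrow> (('a \<Rightarrow> bool) \<times> 'r) set" where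
  "phi A P = (\<lambda>c\<in>carrier A. {z \<in> P. fst z c})"

definition point_topology ::
  "'a mframe \<Rightarrow> (('a \<Rightarrow> bool) \<times> 'r) set \<Rightarrow> (('a \<Rightarrow> bool) \<times> 'r) topology" where
  "point_topology A P = topology (\<lambda>U. U \<in> phi A P ` carrier A)"

definition pair_space :: "'a mframe \<Rightarrow> 'a pair_pt set \<Rightarrow> 'a pair_pt relspace" where
  "pair_space A P = \<lparr>opens = point_topology A P, rel = pair_rel A \<inter> P \<times> P\<rparr>"

definition triple_space :: "'a mframe \<Rightarrow> 'a triple_pt set \<Rightarrow> 'a triple_pt relspace" where
  "triple_space A P = \<lparr>opens = point_topology A P, rel = triple_rel A \<inter> P \<times> P\<rparr>"

definition pts_RelSp :: "'a mframe \<Rightarrow> 'a pair_pt set" where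
  "pts_RelSp A = pair_points A (pre_RelSp A)"

definition pts_RelSp_l :: "'a mframe \<Rightarrow> 'a pair_pt set" where
  "pts_RelSp_l A = pair_points A (pre_RelSp_l A)"

definition pts_RelSpq :: "'a mframe \<Rightarrow> 'a triple_pt set" where
  "pts_RelSpq A = triple_points A (pre_RelSpq A)"

definition pts_RelSpq_l :: "'a mframe \<Rightarrow> 'a triple_pt set" where
  "pts_RelSpq_l A = triple_points A (pre_RelSpq_l A)"

definition pts_RelSpq_u :: "'a mframe \<Rightarrow> 'a triple_pt set" where
  "pts_RelSpq_u A = triple_points A (pre_RelSpq_u A)"

definition pts_RelSpq_c :: "'a mframe \<Rightarrow> 'a triple_pt set" where
  "pts_RelSpq_c A = triple_points A (pre_RelSpq_c A)"

text \<open>\<^const>\<open>topology\<close> is meaningful only for families that satisfy \<^const>\<open>istopology\<close>.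
  This one does, because frame characters preserve finite meets and arbitrary joins.\<close>

lemma two_top: "\<top>\<^bsub>two\<^esub> = True"
proof -
  have "greatest two True (carrier two)"
    by (auto simp: greatest_def two_def)
  then have "greatest two \<top>\<^bsub>two\<^esub> (carrier two)"
    unfolding top_def by (rule someI)
  then show ?thesis
    by (auto simp: greatest_def two_def)
qed

lemma two_meet: "x \<sqinter>\<^bsub>two\<^esub> y \<longleftrightarrow> x \<and> y"
proof -
  have "greatest two (x \<and> y) (Lower two {x, y})"
    by (auto simp: greatest_def Lower_def two_def)
  then have "greatest two (x \<sqinter>\<^bsub>two\<^esub> y) (Lower two {x, y})"
    unfolding meet_def inf_def by (rule someI)
  then have le: "\<And>z. z \<in> Lower two {x, y} \<Longrightarrow> z \<le> x \<sqinter>\<^bsub>two\<^esub> y" and "x \<sqinter>\<^bsub>two\<^esub> y \<le> x" "x \<sqinter>\<^bsub>two\<^esub> y \<le> y"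
    by (auto simp: greatest_def Lower_def two_def)
  moreover have "(x \<and> y) \<le> x \<sqinter>\<^bsub>two\<^esub> y"
    by (rule le) (auto simp: Lower_def two_def)
  ultimately show ?thesis
    by auto
qed

lemma two_sup: "\<Squnion>\<^bsub>two\<^esub> S \<longleftrightarrow> True \<in> S"
proof -
  have "least two (True \<in> S) (Upper two S)"
    by (auto simp: least_def Upper_def two_def)
  then have "least two (\<Squnion>\<^bsub>two\<^esub> S) (Upper two S)"
    unfolding sup_def by (rule someI)
  then have le: "\<And>z. z \<in> Upper two S \<Longrightarrow> \<Squnion>\<^bsub>two\<^esub> S \<le> z" and "\<forall>x\<in>S. x \<le> \<Squnion>\<^bsub>two\<^esub> S"
    by (auto simp: least_def Upper_def two_def)
  moreover have "\<Squnion>\<^bsub>two\<^esub> S \<le> (True \<in> S)"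
    by (rule le) (auto simp: Upper_def two_def)
  ultimately show ?thesis
    by auto
qed

lemma frame_character_simps:
  assumes "frame_character A p"
  shows "p \<top>\<^bsub>A\<^esub>"
    and "\<lbrakk>a \<in> carrier A; b \<in> carrier A\<rbrakk> \<Longrightarrow> p (a \<sqinter>\<^bsub>A\<^esub> b) \<longleftrightarrow> p a \<and> p b"
    and "S \<subseteq> carrier A \<Longrightarrow> p (\<Squnion>\<^bsub>A\<^esub> S) \<longleftrightarrow> (\<exists>a\<in>S. p a)"
  using assms by (auto simp: frame_character_def frame_hom_def two_top two_meet two_sup)

lemma openin_point_topology:
  assumes "modal_frame A" and ch: "\<And>z. z \<in> P \<Longrightarrow> frame_character A (fst z)"
  shows "openin (point_topology A P) U \<longleftrightarrow> U \<in> phi A P ` carrier A"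
    and "topspace (point_topology A P) = P"
proof -
  interpret modal_frame A by fact
  have meet: "phi A P a \<inter> phi A P b = phi A P (a \<sqinter>\<^bsub>A\<^esub> b)"
    if "a \<in> carrier A" "b \<in> carrier A" for a b
  proof -
    have "{z \<in> P. fst z a} \<inter> {z \<in> P. fst z b} = {z \<in> P. fst z (a \<sqinter>\<^bsub>A\<^esub> b)}"
      using frame_character_simps(2)[OF ch that] by blast
    then show ?thesis
      using that by (simp add: phi_def)
  qed
  have Sup: "\<Union> (phi A P ` S) = phi A P (\<Squnion>\<^bsub>A\<^esub> S)" if "S \<subseteq> carrier A" for S
  proof -
    have "(\<Union>a\<in>S. {z \<in> P. fst z a}) = {z \<in> P. fst z (\<Squnion>\<^bsub>A\<^esub> S)}"
      using frame_character_simps(3)[OF ch that] by blast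
    moreover have "phi A P ` S = (\<lambda>a. {z \<in> P. fst z a}) ` S"
      using that by (intro image_cong) (auto simp: phi_def)
    ultimately show ?thesis
      using sup_closed[OF that] by (simp add: phi_def)
  qed
  have "istopology (\<lambda>U. U \<in> phi A P ` carrier A)"
    unfolding istopology_def
  proof (intro conjI allI impI)
    fix U V assume "U \<in> phi A P ` carrier A" "V \<in> phi A P ` carrier A"
    then show "U \<inter> V \<in> phi A P ` carrier A"
      using meet by (auto intro!: imageI)
  next
    fix \<K> assume "\<forall>K\<in>\<K>. K \<in> phi A P ` carrier A"
    then obtain S where "S \<subseteq> carrier A" "\<K> = phi A P ` S"
      by (metis subset_imageE subsetI)
    then show "\<Union> \<K> \<in> phi A P ` carrier A"
      using Sup sup_closed by auto
  qed
  then have open_iff: "openin (point_topology A P) U \<longleftrightarrow> U \<in> phi A P ` carrier A" for U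
    by (simp add: point_topology_def topology_inverse')
  then show "openin (point_topology A P) U \<longleftrightarrow> U \<in> phi A P ` carrier A" .
  have "phi A P \<top>\<^bsub>A\<^esub> = P"
    using frame_character_simps(1)[OF ch] by (auto simp del: split_paired_All simp: phi_def)
  then have "openin (point_topology A P) P"
    unfolding open_iff by (metis imageI top_closed)
  moreover have "U \<subseteq> P" if "openin (point_topology A P) U" for U
    using that unfolding open_iff by (auto simp: phi_def)
  ultimately show "topspace (point_topology A P) = P"
    by (meson openin_subset openin_topspace subset_antisym)
qed


section \<open>Contravariant adjunctions\<close>

text \<open>The argument of type \<open>'x itself\<close> fixes the type of the underlying sets of the
  spaces \<open>X\<close>. The map \<open>F\<close> is the object part of the functor adjoint to \<open>\<Omega>\<close>, and \<open>\<eta>\<close> is the unit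
  on the modal frame side.

  The category \<^const>\<open>RelSp_l\<close> has to be paired with \<^const>\<open>MFrm_dia\<close>, not with \<^const>\<open>MFrm\<close>:
  condition (ii) on pre-points forces every \<open>\<Omega>(g) \<circ> \<phi>\<close> to be diamond-strict. Concretely,
  let \<open>A\<close> be the two-element frame with \<open>box = id\<close> and \<open>dia = \<bottom>\<close>, and \<open>X\<close> the one-point reflexive
  space. The isomorphism of frames \<open>A \<rightarrow> \<Omega> X\<close> is a morphism of \<^const>\<open>MFrm\<close>, but the only point
  of \<open>A\<close> has no related point, so there is no p-morphism from \<open>X\<close> to the space of points.\<close>

definition Omega_functor :: "'x itself \<Rightarrow> relspace_cat \<Rightarrow> mframe_cat \<Rightarrow> bool" where
  "Omega_functor _ D C \<longleftrightarrow>
     (\<forall>X :: 'x relspace. relspace_Ob D X \<longrightarrow>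
        mframe_Ob C (Omega X) \<and>
        Omega_map X X (\<lambda>x\<in>points X. x) = (\<lambda>U\<in>carrier (Omega X). U)) \<and>
     (\<forall>(X :: 'x relspace) (Y :: 'x relspace) g.
        relspace_Ob D X \<and> relspace_Ob D Y \<and> g \<in> relspace_Hom D X Y \<longrightarrow>
        Omega_map X Y g \<in> mframe_Hom C (Omega Y) (Omega X)) \<and>
     (\<forall>(X :: 'x relspace) (Y :: 'x relspace) (Z :: 'x relspace) g h.
        relspace_Ob D X \<and> relspace_Ob D Y \<and> relspace_Ob D Z \<and>
        g \<in> relspace_Hom D X Y \<and> h \<in> relspace_Hom D Y Z \<longrightarrow>
        Omega_map X Z (compose (points X) h g) =
          compose (carrier (Omega Z)) (Omega_map X Y g) (Omega_map Y Z h))"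

definition contravariant_functor ::
  "mframe_cat \<Rightarrow> relspace_cat \<Rightarrow> ('a mframe \<Rightarrow> 'p relspace) \<Rightarrow>
    ('a mframe \<Rightarrow> 'a mframe \<Rightarrow> ('a \<Rightarrow> 'a) \<Rightarrow> 'p \<Rightarrow> 'p) \<Rightarrow> bool" where
  "contravariant_functor C D F Fmap \<longleftrightarrow>
     (\<forall>A. mframe_Ob C A \<longrightarrow>
        relspace_Ob D (F A) \<and>
        Fmap A A (\<lambda>a\<in>carrier A. a) = (\<lambda>z\<in>points (F A). z)) \<and>
     (\<forall>A B f. mframe_Ob C A \<and> mframe_Ob C B \<and> f \<in> mframe_Hom C A B \<longrightarrow>
        Fmap A B f \<in> relspace_Hom D (F B) (F A)) \<and>
     (\<forall>A B E f h. mframe_Ob C A \<and> mframe_Ob C B \<and> mframe_Ob C E \<and>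
        f \<in> mframe_Hom C A B \<and> h \<in> mframe_Hom C B E \<longrightarrow>
        Fmap A E (compose (carrier A) h f) =
          compose (points (F E)) (Fmap A B f) (Fmap B E h))"

definition contravariant_adjunction ::
  "'x itself \<Rightarrow> mframe_cat \<Rightarrow> relspace_cat \<Rightarrow>
    ('a mframe \<Rightarrow> 'p relspace) \<Rightarrow> ('a mframe \<Rightarrow> 'a \<Rightarrow> 'p set) \<Rightarrow> bool" where
  "contravariant_adjunction T C D F \<eta> \<longleftrightarrow>
     Omega_functor T D C \<and>
     (\<forall>A. mframe_Ob C A \<longrightarrow>
        relspace_Ob D (F A) \<and> \<eta> A \<in> mframe_Hom C A (Omega (F A))) \<and>
     (\<forall>A (X :: 'x relspace) f.
        mframe_Ob C A \<and> relspace_Ob D X \<and> f \<in> mframe_Hom C A (Omega X) \<longrightarrow>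
        (\<exists>!g. g \<in> relspace_Hom D X (F A) \<and>
           compose (carrier A) (Omega_map X (F A) g) (\<eta> A) = f)) \<and>
     (\<exists>Fmap. contravariant_functor C D F Fmap \<and>
        (\<forall>A B f. mframe_Ob C A \<and> mframe_Ob C B \<and> f \<in> mframe_Hom C A B \<longrightarrow>
           compose (carrier A) (Omega_map (F B) (F A) (Fmap A B f)) (\<eta> A) =
             compose (carrier A) (\<eta> B) f))"

end

theory Submission
  imports Defs
begin

text \<open>A point \<open>(p, a, F)\<close> of \<open>A\<close> is determined by \<open>p\<close> and its set of successors: conditions (D)
  and (B), with the definition of the relation, say that \<open>c \<sqsubseteq> a\<close> iff no successor \<open>q\<close> has
  \<open>q c\<close>, and that \<open>c \<in> F\<close> iff every successor \<open>q\<close> has \<open>q c\<close>. Conditions (2) and (3) on a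
  morphism \<open>g\<close> say that the successors of \<open>g x\<close> meet, respectively leave, the same open sets as
  the images of the successors of \<open>x\<close>. Hence a transpose \<open>g\<close> of \<open>f : A \<rightarrow> \<Omega> X\<close> has to be
  \<open>g x = (p, a, F)\<close> with \<open>p c\<close> iff \<open>x \<in> f c\<close>, \<open>a\<close> the largest element whose image under \<open>f\<close>
  avoids all successors of \<open>x\<close>, and \<open>F\<close> the set of all \<open>c\<close> with \<open>f c\<close> containing all of them.
  Conversely these pre-points form a saturated set, so they are points. Conditions (ii) and
  (iv) make \<open>\<diamond>\<close> and \<open>\<box>\<close> of \<open>\<phi> c\<close> equal to \<open>\<phi> (\<diamond> c)\<close> and \<open>\<phi> (\<box> c)\<close>
  before taking interiors, which gives strictness and semicontinuity together.\<close>

section \<open>The modal frame of a relational space\<close>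

lemma Omega_simps [simp]:
  "carrier (Omega X) = {U. openin (opens X) U}"
  "le (Omega X) = (\<subseteq>)"
  "eq (Omega X) = (=)"
  "box (Omega X) U = opens X interior_of box_rel X U"
  "dia (Omega X) U = opens X interior_of dia_rel X U"
  by (simp_all add: Omega_def)

lemma mem_box_rel: "x \<in> box_rel X U \<longleftrightarrow> x \<in> points X \<and> (\<forall>y. (x, y) \<in> rel X \<longrightarrow> y \<in> U)"
  and mem_dia_rel: "x \<in> dia_rel X U \<longleftrightarrow> x \<in> points X \<and> (\<exists>y. (x, y) \<in> rel X \<and> y \<in> U)"
  by (auto simp: box_rel_def dia_rel_def)

lemma partial_order_Omega: "partial_order (Omega X)"
  by unfold_locales auto

lemma least_Omega:
  "S \<subseteq> carrier (Omega X) \<Longrightarrow> least (Omega X) (\<Union>S) (Upper (Omega X) S)"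
  by (rule least_UpperI) (auto simp: Upper_def)

text \<open>An intersection of open sets need not be open, so the infimum is its interior. The
  factor \<open>points X\<close> makes the empty family yield the whole space.\<close>

lemma greatest_Omega:
  "S \<subseteq> carrier (Omega X) \<Longrightarrow>
    greatest (Omega X) (opens X interior_of (points X \<inter> \<Inter>S)) (Lower (Omega X) S)"
proof (rule greatest_LowerI)
  fix U assume S: "S \<subseteq> carrier (Omega X)" and U: "U \<in> Lower (Omega X) S"
  then have "openin (opens X) U" "U \<subseteq> points X \<inter> \<Inter>S"
    by (auto simp: Lower_def dest: openin_subset)
  then show "le (Omega X) U (opens X interior_of (points X \<inter> \<Inter>S))"
    by (simp add: interior_of_maximal)
qed (auto dest: subsetD[OF interior_of_subset])

lemma complete_lattice_Omega: "complete_lattice (Omega X)"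
proof -
  interpret partial_order "Omega X" by (rule partial_order_Omega)
  show ?thesis
    by unfold_locales (blast intro: least_Omega greatest_Omega)+
qed

lemma sup_Omega: "S \<subseteq> carrier (Omega X) \<Longrightarrow> \<Squnion>\<^bsub>Omega X\<^esub> S = \<Union>S"
proof -
  interpret complete_lattice "Omega X" by (rule complete_lattice_Omega)
  assume "S \<subseteq> carrier (Omega X)"
  then show ?thesis
    by (intro least_unique[OF sup_lub least_Omega]) auto
qed

lemma top_Omega: "\<top>\<^bsub>Omega X\<^esub> = points X"
proof -
  interpret complete_lattice "Omega X" by (rule complete_lattice_Omega)
  show ?thesis
    using top_closed top_higher[of "points X"] openin_subset by auto
qed

lemma bottom_Omega: "\<bottom>\<^bsub>Omega X\<^esub> = {}"
proof -
  interpret complete_lattice "Omega X" by (rule complete_lattice_Omega)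
  show ?thesis
    using bottom_lower[of "{}"] by auto
qed

lemma meet_Omega:
  assumes "openin (opens X) U" "openin (opens X) V"
  shows "U \<sqinter>\<^bsub>Omega X\<^esub> V = U \<inter> V"
proof -
  interpret complete_lattice "Omega X" by (rule complete_lattice_Omega)
  have "le (Omega X) (U \<sqinter>\<^bsub>Omega X\<^esub> V) U" "le (Omega X) (U \<sqinter>\<^bsub>Omega X\<^esub> V) V"
    using assms by (auto intro!: meet_left meet_right simp del: Omega_simps(2))
  moreover have "le (Omega X) (U \<inter> V) (U \<sqinter>\<^bsub>Omega X\<^esub> V)"
    using assms by (intro meet_le) auto
  ultimately show ?thesis by auto
qed

text \<open>For \<open>box_rel\<close> and \<open>dia_rel\<close> the axioms hold pointwise. They
  survive taking interiors, because interior is monotone and commutes with binary intersections,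
  which are the meets.\<close>

lemma modal_frame_Omega:
  assumes "relational_space X"
  shows "modal_frame (Omega X)"
proof -
  interpret complete_lattice "Omega X" by (rule complete_lattice_Omega)
  have "frame (Omega X)"
  proof
    fix U S assume US: "U \<in> carrier (Omega X)" "S \<subseteq> carrier (Omega X)"
    then have "\<And>V. V \<in> S \<Longrightarrow> U \<sqinter>\<^bsub>Omega X\<^esub> V = U \<inter> V"
      by (auto intro!: meet_Omega)
    moreover have "openin (opens X) (\<Union>S)"
      using US by auto
    moreover have "(\<inter>) U ` S \<subseteq> carrier (Omega X)"
      using US by auto
    ultimately show "U \<sqinter>\<^bsub>Omega X\<^esub> (\<Squnion>\<^bsub>Omega X\<^esub> S) = \<Squnion>\<^bsub>Omega X\<^esub> (\<lambda>V. U \<sqinter>\<^bsub>Omega X\<^esub> V) ` S"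
      using US by (simp add: sup_Omega meet_Omega cong: image_cong)
  qed
  then interpret frame "Omega X" .
  have R: "rel X \<subseteq> points X \<times> points X"
    using assms by (simp add: relational_space_def)
  show ?thesis
  proof
    show "\<top>\<^bsub>Omega X\<^esub> \<sqsubseteq>\<^bsub>Omega X\<^esub> box (Omega X) \<top>\<^bsub>Omega X\<^esub>"
    proof -
      have "box_rel X (points X) = points X"
        using R by (auto simp: box_rel_def)
      then show ?thesis
        by (simp add: top_Omega)
    qed
  next
    fix U V assume "U \<in> carrier (Omega X)" "V \<in> carrier (Omega X)"
    moreover have "box_rel X U \<inter> box_rel X V = box_rel X (U \<inter> V)"
      by (auto simp: box_rel_def)
    ultimately show "box (Omega X) U \<sqinter>\<^bsub>Omega X\<^esub> box (Omega X) V
        \<sqsubseteq>\<^bsub>Omega X\<^esub> box (Omega X) (U \<sqinter>\<^bsub>Omega X\<^esub> V)"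
      by (simp add: meet_Omega flip: interior_of_Int)
  next
    fix U V assume "U \<in> carrier (Omega X)" "V \<in> carrier (Omega X)"
    moreover have "box_rel X U \<inter> dia_rel X V \<subseteq> dia_rel X (U \<inter> V)"
      by (auto simp: box_rel_def dia_rel_def)
    ultimately show "box (Omega X) U \<sqinter>\<^bsub>Omega X\<^esub> dia (Omega X) V
        \<sqsubseteq>\<^bsub>Omega X\<^esub> dia (Omega X) (U \<sqinter>\<^bsub>Omega X\<^esub> V)"
      by (simp add: meet_Omega interior_of_mono flip: interior_of_Int)
  next
    have "dia_rel X {} = {}"
      by (auto simp: dia_rel_def)
    then show "dia (Omega X) \<bottom>\<^bsub>Omega X\<^esub> \<sqsubseteq>\<^bsub>Omega X\<^esub> \<bottom>\<^bsub>Omega X\<^esub>"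
      by (simp add: bottom_Omega)
  qed (auto intro!: interior_of_mono simp: box_rel_def dia_rel_def)
qed

lemma box_Omega_usc:
  "usc X \<Longrightarrow> openin (opens X) U \<Longrightarrow> box (Omega X) U = box_rel X U"
  by (simp add: usc_def interior_of_openin)

lemma dia_Omega_lsc:
  "lsc X \<Longrightarrow> openin (opens X) U \<Longrightarrow> dia (Omega X) U = dia_rel X U"
  by (simp add: lsc_def interior_of_openin)

text \<open>Semicontinuity removes the interiors. What remains is the familiar correspondence of the
  T, 4 and B axioms with reflexivity, transitivity and symmetry.\<close>

lemma equivalence_frame_Omega:
  assumes X: "relational_space X" "usc X" "lsc X" and eq: "equiv (points X) (rel X)"
  shows "equivalence_frame (Omega X)"
proof -
  interpret modal_frame "Omega X" using X(1) by (rule modal_frame_Omega)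
  have refl: "\<And>x. x \<in> points X \<Longrightarrow> (x, x) \<in> rel X"
    and sym: "\<And>x y. (x, y) \<in> rel X \<Longrightarrow> (y, x) \<in> rel X"
    and trans: "\<And>x y z. (x, y) \<in> rel X \<Longrightarrow> (y, z) \<in> rel X \<Longrightarrow> (x, z) \<in> rel X"
    using eq by (auto simp: equiv_def refl_on_def dest: symD transD)
  have R: "\<And>x y. (x, y) \<in> rel X \<Longrightarrow> x \<in> points X \<and> y \<in> points X"
    using X(1) by (auto simp: relational_space_def)
  show ?thesis
  proof
    fix U assume "U \<in> carrier (Omega X)"
    then have U: "openin (opens X) U" "openin (opens X) (box_rel X U)"
        "openin (opens X) (dia_rel X U)"
      using X by (auto simp: usc_def lsc_def)
    have "U \<subseteq> points X"
      using U(1) by (rule openin_subset)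
    then have "box_rel X U \<subseteq> U" "U \<subseteq> dia_rel X U" "box_rel X U \<subseteq> box_rel X (box_rel X U)"
        "dia_rel X (dia_rel X U) \<subseteq> dia_rel X U" "dia_rel X (box_rel X U) \<subseteq> U"
        "U \<subseteq> box_rel X (dia_rel X U)"
      unfolding subset_iff mem_box_rel mem_dia_rel using refl sym trans R by meson+
    then show "box (Omega X) U \<sqsubseteq>\<^bsub>Omega X\<^esub> U" "U \<sqsubseteq>\<^bsub>Omega X\<^esub> dia (Omega X) U"
        "box (Omega X) U \<sqsubseteq>\<^bsub>Omega X\<^esub> box (Omega X) (box (Omega X) U)"
        "dia (Omega X) (dia (Omega X) U) \<sqsubseteq>\<^bsub>Omega X\<^esub> dia (Omega X) U"
        "dia (Omega X) (box (Omega X) U) \<sqsubseteq>\<^bsub>Omega X\<^esub> U"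
        "U \<sqsubseteq>\<^bsub>Omega X\<^esub> box (Omega X) (dia (Omega X) U)"
      \<comment> \<open>The unfolding of \<open>box\<close> and \<open>dia\<close> to interiors is
        switched off, so that they rewrite to \<open>box_rel\<close> and \<open>dia_rel\<close> even
        when nested.\<close>
      by (simp_all add: box_Omega_usc[OF X(2)] dia_Omega_lsc[OF X(3)] U del: Omega_simps(4,5))
  qed
qed


section \<open>Categories of modal frames and of relational spaces\<close>

lemma mframe_Ob_modal_frame: "mframe_Ob C A \<Longrightarrow> modal_frame A"
  by (cases C) (auto simp: equivalence_frame_def)

lemma modal_frame_hom_id: "modal_frame A \<Longrightarrow> (\<lambda>a\<in>carrier A. a) \<in> modal_frame_hom A A"
proof -
  assume "modal_frame A"
  then interpret modal_frame A .
  have "(\<lambda>a\<in>carrier A. a) ` S = S" if "S \<subseteq> carrier A" for S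
    using that by (auto simp: image_iff)
  then show ?thesis
    by (auto simp: modal_frame_hom_def frame_hom_def box_closed dia_closed)
qed

lemma mframe_Hom_id:
  assumes "mframe_Ob C A"
  shows "(\<lambda>a\<in>carrier A. a) \<in> mframe_Hom C A A"
proof -
  interpret modal_frame A using assms by (rule mframe_Ob_modal_frame)
  show ?thesis
    using modal_frame_hom_id[OF modal_frame_axioms]
    by (cases C) (auto simp: box_strict_def dia_strict_def box_closed dia_closed)
qed

lemma frame_hom_closed: "f \<in> frame_hom A B \<Longrightarrow> a \<in> carrier A \<Longrightarrow> f a \<in> carrier B"
  by (auto simp: frame_hom_def)

lemma frame_hom_mono:
  assumes "lattice A" "lattice B" and f: "f \<in> frame_hom A B"
    and ab: "a \<in> carrier A" "b \<in> carrier A" and le: "a \<sqsubseteq>\<^bsub>A\<^esub> b"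
  shows "f a \<sqsubseteq>\<^bsub>B\<^esub> f b"
proof -
  interpret A: lattice A by fact
  interpret B: lattice B by fact
  have "a \<sqinter>\<^bsub>A\<^esub> b = a"
    using ab le A.le_iff_join by auto
  moreover have "f (a \<sqinter>\<^bsub>A\<^esub> b) = f a \<sqinter>\<^bsub>B\<^esub> f b"
    using f ab by (simp add: frame_hom_def)
  ultimately have "f a = f a \<sqinter>\<^bsub>B\<^esub> f b"
    by simp
  moreover have "f a \<in> carrier B" "f b \<in> carrier B"
    using f ab by (auto intro: frame_hom_closed)
  ultimately show ?thesis
    by (simp add: B.le_iff_join)
qed

lemma frame_hom_compose:
  assumes f: "f \<in> frame_hom A B" and h: "h \<in> frame_hom B E" and A: "complete_lattice A"
  shows "compose (carrier A) h f \<in> frame_hom A E"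
proof -
  interpret complete_lattice A by fact
  have cl: "f a \<in> carrier B" if "a \<in> carrier A" for a
    using f that by (rule frame_hom_closed)
  have "compose (carrier A) h f (\<Squnion>\<^bsub>A\<^esub> S) = \<Squnion>\<^bsub>E\<^esub> (compose (carrier A) h f ` S)"
    if S: "S \<subseteq> carrier A" for S
  proof -
    have "compose (carrier A) h f (\<Squnion>\<^bsub>A\<^esub> S) = h (\<Squnion>\<^bsub>B\<^esub> (f ` S))"
      using f S by (simp add: compose_def frame_hom_def)
    also have "\<dots> = \<Squnion>\<^bsub>E\<^esub> (h ` f ` S)"
    proof -
      have "f ` S \<subseteq> carrier B"
        using S cl by blast
      then show ?thesis
        using h by (simp add: frame_hom_def)
    qed
    also have "h ` f ` S = compose (carrier A) h f ` S"
      using S by (auto simp: compose_def image_image intro!: image_cong)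
    finally show ?thesis .
  qed
  moreover have "compose (carrier A) h f \<in> carrier A \<rightarrow>\<^sub>E carrier E"
    using cl frame_hom_closed[OF h] by (auto simp: compose_def)
  ultimately show ?thesis
    using f h cl by (simp add: frame_hom_def compose_def)
qed

text \<open>The inequality for \<open>f\<close> is pushed forward along \<open>h\<close>, which is
  monotone because it preserves meets, and is then chained with the inequality for
  \<open>h\<close>.\<close>

lemma modal_frame_hom_compose:
  assumes "modal_frame A" "modal_frame B" "modal_frame E"
    and f: "f \<in> modal_frame_hom A B" and h: "h \<in> modal_frame_hom B E"
  shows "compose (carrier A) h f \<in> modal_frame_hom A E"
proof -
  interpret A: modal_frame A by fact
  interpret B: modal_frame B by fact
  interpret E: modal_frame E by fact
  have ff: "f \<in> frame_hom A B" and hh: "h \<in> frame_hom B E"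
    using f h by (auto simp: modal_frame_hom_def)
  note mono = frame_hom_mono[OF B.lattice_axioms E.lattice_axioms hh]
  note fcl = frame_hom_closed[OF ff] and hcl = frame_hom_closed[OF hh]
  have "h (f (box A a)) \<sqsubseteq>\<^bsub>E\<^esub> box E (h (f a))" if a: "a \<in> carrier A" for a
  proof (rule E.le_trans)
    show "h (f (box A a)) \<sqsubseteq>\<^bsub>E\<^esub> h (box B (f a))"
      using f a by (intro mono) (auto simp: modal_frame_hom_def fcl A.box_closed B.box_closed)
    show "h (box B (f a)) \<sqsubseteq>\<^bsub>E\<^esub> box E (h (f a))"
      using h fcl[OF a] by (auto simp: modal_frame_hom_def)
  qed (auto simp: a fcl hcl A.box_closed B.box_closed E.box_closed)
  moreover have "h (f (dia A a)) \<sqsubseteq>\<^bsub>E\<^esub> dia E (h (f a))" if a: "a \<in> carrier A" for a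
  proof (rule E.le_trans)
    show "h (f (dia A a)) \<sqsubseteq>\<^bsub>E\<^esub> h (dia B (f a))"
      using f a by (intro mono) (auto simp: modal_frame_hom_def fcl A.dia_closed B.dia_closed)
    show "h (dia B (f a)) \<sqsubseteq>\<^bsub>E\<^esub> dia E (h (f a))"
      using h fcl[OF a] by (auto simp: modal_frame_hom_def)
  qed (auto simp: a fcl hcl A.dia_closed B.dia_closed E.dia_closed)
  ultimately show ?thesis
    using frame_hom_compose[OF ff hh A.complete_lattice_axioms]
    by (auto simp: modal_frame_hom_def compose_def A.box_closed A.dia_closed)
qed

lemma mframe_Hom_modal_frame_hom: "f \<in> mframe_Hom C A B \<Longrightarrow> f \<in> modal_frame_hom A B"
  by (cases C) auto

lemma mframe_Hom_compose:
  assumes "modal_frame A" "modal_frame B" "modal_frame E"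
    and f: "f \<in> mframe_Hom C A B" and h: "h \<in> mframe_Hom C B E"
  shows "compose (carrier A) h f \<in> mframe_Hom C A E"
proof -
  interpret A: modal_frame A by fact
  note f' = mframe_Hom_modal_frame_hom[OF f] and h' = mframe_Hom_modal_frame_hom[OF h]
  have cl: "\<And>a. a \<in> carrier A \<Longrightarrow> f a \<in> carrier B"
    using f' by (auto simp: modal_frame_hom_def frame_hom_closed)
  show ?thesis
    using modal_frame_hom_compose[OF assms(1-3) f' h'] f h cl
    by (cases C) (auto simp: box_strict_def dia_strict_def compose_def A.box_closed A.dia_closed)
qed

section \<open>Identities and composites of p-morphisms and pq-morphisms\<close>

lemma relspace_Ob_relational: "relspace_Ob D X \<Longrightarrow> relational_space X"
  by (cases D) auto

lemma p_morphism_id: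
  "relational_space X \<Longrightarrow> p_morphism X X (\<lambda>x\<in>points X. x)"
  by (fastforce simp: p_morphism_def relational_space_def)

lemma pq_morphism_id:
  "relational_space X \<Longrightarrow> pq_morphism X X (\<lambda>x\<in>points X. x)"
  using p_morphism_id by (fastforce simp: pq_morphism_def relational_space_def)

lemma relspace_Hom_id:
  "relational_space X \<Longrightarrow> (\<lambda>x\<in>points X. x) \<in> relspace_Hom D X X"
  by (cases D) (auto simp: p_morphism_id pq_morphism_id)

lemma p_morphism_closed: "p_morphism X Y g \<Longrightarrow> x \<in> points X \<Longrightarrow> g x \<in> points Y"
  by (auto simp: p_morphism_def continuous_map_def)

lemma openin_p_morphism_vimage:
  "p_morphism X Y g \<Longrightarrow> openin (opens Y) V \<Longrightarrow> openin (opens X) (g -` V \<inter> points X)"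
  by (auto simp: p_morphism_def continuous_map_def vimage_def Int_def conj_commute)

text \<open>Condition (2) for \<open>h\<close> gives a successor of \<open>g x\<close> in the
  preimage of \<open>U\<close> under \<open>h\<close>. This preimage is open by continuity, so
  condition (2) for \<open>g\<close> applies to it.\<close>

lemma p_morphism_compose:
  assumes X: "relational_space X" and Y: "relational_space Y"
    and g: "p_morphism X Y g" and h: "p_morphism Y Z h"
  shows "p_morphism X Z (compose (points X) h g)"
proof -
  have R: "\<And>x y. (x, y) \<in> rel X \<Longrightarrow> x \<in> points X \<and> y \<in> points X"
    using X by (auto simp: relational_space_def)
  have "continuous_map (opens X) (opens Z) (h \<circ> g)"
    using g h by (auto simp: p_morphism_def intro: continuous_map_compose)
  then have "continuous_map (opens X) (opens Z) (compose (points X) h g)"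
    by (rule continuous_map_eq) (auto simp: compose_def)
  moreover have "\<exists>x'. (x, x') \<in> rel X \<and> compose (points X) h g x' \<in> U"
    if U: "openin (opens Z) U" and x: "x \<in> points X"
      and z: "(compose (points X) h g x, z) \<in> rel Z" "z \<in> U" for U x z
  proof -
    obtain y where y: "(g x, y) \<in> rel Y" "h y \<in> U"
      using h U x z p_morphism_closed[OF g x] by (simp add: p_morphism_def compose_def) blast
    then have "y \<in> h -` U \<inter> points Y"
      using Y by (auto simp: relational_space_def)
    then obtain x' where "(x, x') \<in> rel X" "g x' \<in> h -` U \<inter> points Y"
      using g x y(1) openin_p_morphism_vimage[OF h U] unfolding p_morphism_def by blast
    then show ?thesis
      using R by (auto simp: compose_def)
  qed
  moreover have "(compose (points X) h g x, compose (points X) h g x') \<in> rel Z"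
    if "(x, x') \<in> rel X" for x x'
    using g h R[OF that] that by (simp add: p_morphism_def compose_def)
  ultimately show ?thesis
    unfolding p_morphism_def by (blast intro: compose_extensional)
qed

lemma pq_morphism_compose:
  assumes X: "relational_space X" and Y: "relational_space Y"
    and g: "pq_morphism X Y g" and h: "pq_morphism Y Z h"
  shows "pq_morphism X Z (compose (points X) h g)"
proof -
  have R: "\<And>x y. (x, y) \<in> rel X \<Longrightarrow> x \<in> points X \<and> y \<in> points X"
    using X by (auto simp: relational_space_def)
  have g': "p_morphism X Y g" and h': "p_morphism Y Z h"
    using g h by (auto simp: pq_morphism_def)
  have "\<exists>x'. (x, x') \<in> rel X \<and> compose (points X) h g x' \<notin> U"
    if U: "openin (opens Z) U" and x: "x \<in> points X"
      and z: "(compose (points X) h g x, z) \<in> rel Z" "z \<notin> U" for U x z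
  proof -
    obtain y where y: "(g x, y) \<in> rel Y" "h y \<notin> U"
      using h U x z p_morphism_closed[OF g' x] by (simp add: pq_morphism_def compose_def) blast
    then have "y \<notin> h -` U \<inter> points Y"
      by auto
    then obtain x' where "(x, x') \<in> rel X" "g x' \<notin> h -` U \<inter> points Y"
      using g x y(1) openin_p_morphism_vimage[OF h' U] unfolding pq_morphism_def by blast
    \<comment> \<open>As \<open>g x'\<close> lies in \<open>points Y\<close>, leaving the preimage
      of \<open>U\<close> means that \<open>h\<close> sends it outside \<open>U\<close>.\<close>
    then show ?thesis
      using R p_morphism_closed[OF g'] by (auto simp: compose_def)
  qed
  then show ?thesis
    using p_morphism_compose[OF X Y g' h'] by (auto simp: pq_morphism_def)
qed

lemma relspace_Hom_compose:
  assumes "relational_space X" "relational_space Y"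
    and "g \<in> relspace_Hom D X Y" "h \<in> relspace_Hom D Y Z"
  shows "compose (points X) h g \<in> relspace_Hom D X Z"
  using assms by (cases D) (auto intro: p_morphism_compose pq_morphism_compose)

lemma relspace_Hom_p_morphism: "g \<in> relspace_Hom D X Y \<Longrightarrow> p_morphism X Y g"
  by (cases D) (auto simp: pq_morphism_def)


section \<open>Functoriality of \<open>\<Omega>\<close>\<close>

lemma Omega_map_apply:
  "openin (opens Y) V \<Longrightarrow> Omega_map X Y g V = g -` V \<inter> points X"
  by (simp add: Omega_map_def)

lemma Omega_map_id: "Omega_map X X (\<lambda>x\<in>points X. x) = (\<lambda>U\<in>carrier (Omega X). U)"
  unfolding Omega_map_def
proof (rule restrict_ext)
  fix V assume "V \<in> carrier (Omega X)"
  then have "V \<subseteq> points X"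
    by (simp add: openin_subset)
  then show "(\<lambda>x\<in>points X. x) -` V \<inter> points X = V"
    by auto
qed

lemma Omega_map_compose:
  assumes g: "p_morphism X Y g" and h: "p_morphism Y Z h"
  shows "Omega_map X Z (compose (points X) h g) =
    compose (carrier (Omega Z)) (Omega_map X Y g) (Omega_map Y Z h)"
  using p_morphism_closed[OF g] openin_p_morphism_vimage[OF h]
  by (auto simp: Omega_map_def compose_def fun_eq_iff)

lemma Omega_map_frame_hom:
  assumes g: "p_morphism X Y g"
  shows "Omega_map X Y g \<in> frame_hom (Omega Y) (Omega X)"
proof -
  note op = openin_p_morphism_vimage[OF g]
  have "Omega_map X Y g (\<Squnion>\<^bsub>Omega Y\<^esub> S) = \<Squnion>\<^bsub>Omega X\<^esub> (Omega_map X Y g ` S)"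
    if S: "S \<subseteq> carrier (Omega Y)" for S
  proof -
    have eq: "Omega_map X Y g ` S = (\<lambda>V. g -` V \<inter> points X) ` S"
      using S by (auto simp: Omega_map_apply intro!: image_cong)
    moreover have "\<dots> \<subseteq> carrier (Omega X)"
      using S op by auto
    moreover have "openin (opens Y) (\<Union>S)"
      using S by auto
    ultimately show ?thesis
      using S by (auto simp: sup_Omega Omega_map_apply)
  qed
  moreover have "Omega_map X Y g \<in> carrier (Omega Y) \<rightarrow>\<^sub>E carrier (Omega X)"
    using op by (auto simp: Omega_map_def)
  moreover have "Omega_map X Y g \<top>\<^bsub>Omega Y\<^esub> = \<top>\<^bsub>Omega X\<^esub>"
    using p_morphism_closed[OF g] by (auto simp: top_Omega Omega_map_apply)
  moreover have "Omega_map X Y g (U \<sqinter>\<^bsub>Omega Y\<^esub> V) =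
      Omega_map X Y g U \<sqinter>\<^bsub>Omega X\<^esub> Omega_map X Y g V"
    if "openin (opens Y) U" "openin (opens Y) V" for U V
    using that op by (auto simp: meet_Omega Omega_map_apply openin_Int)
  ultimately show ?thesis
    by (simp add: frame_hom_def)
qed

text \<open>Condition (1) gives the inclusion for \<open>box_rel\<close> and one of the two
  inclusions for \<open>dia_rel\<close>; the other one is condition (2).\<close>

lemma
  assumes X: "relational_space X" and Y: "relational_space Y" and g: "p_morphism X Y g"
    and V: "openin (opens Y) V"
  shows vimage_box_rel: "g -` box_rel Y V \<inter> points X \<subseteq> box_rel X (g -` V \<inter> points X)"
    and vimage_dia_rel: "g -` dia_rel Y V \<inter> points X = dia_rel X (g -` V \<inter> points X)"
proof -
  have hom: "\<And>x x'. (x, x') \<in> rel X \<Longrightarrow> (g x, g x') \<in> rel Y \<and> x \<in> points X \<and> x' \<in> points X"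
    using g X by (auto simp: p_morphism_def relational_space_def)
  have lift: "\<exists>x'. (x, x') \<in> rel X \<and> g x' \<in> V"
    if "x \<in> points X" "(g x, y) \<in> rel Y" "y \<in> V" for x y
    using g V that unfolding p_morphism_def by blast
  show "g -` box_rel Y V \<inter> points X \<subseteq> box_rel X (g -` V \<inter> points X)"
    using hom by (auto simp: box_rel_def)
  show "g -` dia_rel Y V \<inter> points X = dia_rel X (g -` V \<inter> points X)"
    using hom p_morphism_closed[OF g] by (auto simp: dia_rel_def) (blast dest: lift hom)+
qed

text \<open>The inclusion missing for p-morphisms is condition (3): a successor of
  \<open>g x\<close> outside \<open>V\<close> yields a successor of \<open>x\<close> that
  \<open>g\<close> sends outside \<open>V\<close>.\<close>

lemma vimage_box_rel_pq:
  assumes X: "relational_space X" and Y: "relational_space Y" and g: "pq_morphism X Y g"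
    and V: "openin (opens Y) V"
  shows "g -` box_rel Y V \<inter> points X = box_rel X (g -` V \<inter> points X)"
proof
  have g': "p_morphism X Y g"
    using g by (simp add: pq_morphism_def)
  show "g -` box_rel Y V \<inter> points X \<subseteq> box_rel X (g -` V \<inter> points X)"
    by (rule vimage_box_rel[OF X Y g' V])
  have "\<exists>x'. (x, x') \<in> rel X \<and> g x' \<notin> V"
    if "x \<in> points X" "(g x, y) \<in> rel Y" "y \<notin> V" for x y
    using g V that unfolding pq_morphism_def by blast
  then show "box_rel X (g -` V \<inter> points X) \<subseteq> g -` box_rel Y V \<inter> points X"
    using p_morphism_closed[OF g'] by (fastforce simp: box_rel_def)
qed

text \<open>By continuity the preimage of an interior is open, so it lies in the interior of any set
  that contains it.\<close>

lemma Omega_map_modal_frame_hom: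
  assumes X: "relational_space X" and Y: "relational_space Y" and g: "p_morphism X Y g"
  shows "Omega_map X Y g \<in> modal_frame_hom (Omega Y) (Omega X)"
proof -
  note op = openin_p_morphism_vimage[OF g]
  have "g -` (opens Y interior_of box_rel Y V) \<inter> points X
      \<subseteq> opens X interior_of box_rel X (g -` V \<inter> points X)" if "openin (opens Y) V" for V
    using vimage_box_rel[OF X Y g that] op[OF openin_interior_of, of "box_rel Y V"]
      interior_of_subset[of "opens Y" "box_rel Y V"]
    by (intro interior_of_maximal) blast+
  moreover have "g -` (opens Y interior_of dia_rel Y V) \<inter> points X
      \<subseteq> opens X interior_of dia_rel X (g -` V \<inter> points X)" if "openin (opens Y) V" for V
    using vimage_dia_rel[OF X Y g that] op[OF openin_interior_of, of "dia_rel Y V"]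
      interior_of_subset[of "opens Y" "dia_rel Y V"]
    by (intro interior_of_maximal) blast+
  ultimately show ?thesis
    using Omega_map_frame_hom[OF g] by (auto simp: modal_frame_hom_def Omega_map_apply)
qed

text \<open>Lower semicontinuity of both spaces makes the interiors trivial, and strictness is then
  the equality \<open>vimage_dia_rel\<close>.\<close>

lemma Omega_map_dia_strict:
  assumes X: "relational_space X" "lsc X" and Y: "relational_space Y" "lsc Y"
    and g: "p_morphism X Y g"
  shows "dia_strict (Omega Y) (Omega X) (Omega_map X Y g)"
  using vimage_dia_rel[OF X(1) Y(1) g] openin_p_morphism_vimage[OF g] X(2) Y(2)
  by (simp add: dia_strict_def Omega_map_apply lsc_def interior_of_openin)

lemma Omega_map_box_strict:
  assumes X: "relational_space X" "usc X" and Y: "relational_space Y" "usc Y"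
    and g: "pq_morphism X Y g"
  shows "box_strict (Omega Y) (Omega X) (Omega_map X Y g)"
proof -
  have "p_morphism X Y g"
    using g by (simp add: pq_morphism_def)
  then show ?thesis
    using vimage_box_rel_pq[OF X(1) Y(1) g] openin_p_morphism_vimage[of X Y g] X(2) Y(2)
    by (simp add: box_strict_def Omega_map_apply usc_def interior_of_openin)
qed

text \<open>Strictness mirrors semicontinuity: diamond-strict morphisms go with lower, box-strict
  ones with upper semicontinuous spaces.\<close>

fun mframe_cat_of :: "relspace_cat \<Rightarrow> mframe_cat" where
  "mframe_cat_of RelSp = MFrm"
| "mframe_cat_of RelSp_l = MFrm_dia"
| "mframe_cat_of RelSpq = MFrm"
| "mframe_cat_of RelSpq_l = MFrm_dia"
| "mframe_cat_of RelSpq_u = MFrm_box"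
| "mframe_cat_of RelSpq_c = MFrm_boxdia"
| "mframe_cat_of EqSpq = EqFrm"

lemma mframe_Ob_Omega: "relspace_Ob D X \<Longrightarrow> mframe_Ob (mframe_cat_of D) (Omega X)"
  by (cases D) (auto simp: modal_frame_Omega equivalence_frame_Omega)

lemma Omega_map_in_Hom:
  assumes "relspace_Ob D X" "relspace_Ob D Y" "g \<in> relspace_Hom D X Y"
  shows "Omega_map X Y g \<in> mframe_Hom (mframe_cat_of D) (Omega Y) (Omega X)"
  using assms Omega_map_modal_frame_hom[of X Y g] relspace_Hom_p_morphism[OF assms(3)]
  by (cases D) (auto simp: Omega_map_dia_strict Omega_map_box_strict)

lemma Omega_functor: "Omega_functor T D (mframe_cat_of D)"
  unfolding Omega_functor_def
  by (intro conjI allI impI)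
    (auto intro: mframe_Ob_Omega Omega_map_id Omega_map_in_Hom Omega_map_compose relspace_Hom_p_morphism
      simp del: Omega_simps)

section \<open>Spaces of points\<close>

text \<open>Pairs \<open>(p, a)\<close> and triples \<open>(p, a, F)\<close> are treated alike: \<open>low\<close> reads off the
  component \<open>a\<close>, and for triples \<open>up\<close> reads off \<open>F\<close>.\<close>

locale point_space = modal_frame A for A :: "'a mframe" (structure) +
  fixes P :: "(('a \<Rightarrow> bool) \<times> 'r) set"
    and R :: "((('a \<Rightarrow> bool) \<times> 'r) \<times> (('a \<Rightarrow> bool) \<times> 'r)) set"
    and low :: "('a \<Rightarrow> bool) \<times> 'r \<Rightarrow> 'a"
  assumes character: "z \<in> P \<Longrightarrow> frame_character A (fst z)"
    and rel_points: "R \<subseteq> P \<times> P"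
    and low_closed: "z \<in> P \<Longrightarrow> low z \<in> carrier A"
    and not_dia_low: "z \<in> P \<Longrightarrow> \<not> fst z (dia A (low z))"
    and rel_low: "(z, w) \<in> R \<Longrightarrow> \<not> fst w (low z)"
    and rel_box: "\<lbrakk>(z, w) \<in> R; c \<in> carrier A; fst z (box A c)\<rbrakk> \<Longrightarrow> fst w c"
    and ex_rel_dia: "\<lbrakk>z \<in> P; c \<in> carrier A; \<not> c \<sqsubseteq> low z\<rbrakk> \<Longrightarrow> \<exists>w. (z, w) \<in> R \<and> fst w c"
begin

abbreviation "space \<equiv> \<lparr>opens = point_topology A P, rel = R\<rparr>"

lemma openin_space: "openin (point_topology A P) U \<longleftrightarrow> U \<in> phi A P ` carrier A"
  using modal_frame_axioms character by (rule openin_point_topology)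

lemma topspace_space [simp]: "topspace (point_topology A P) = P"
  using modal_frame_axioms character by (rule openin_point_topology)

lemma relational_space_space: "relational_space space"
  using rel_points by (simp add: relational_space_def)

lemma phi_apply: "c \<in> carrier A \<Longrightarrow> phi A P c = {z \<in> P. fst z c}"
  by (simp add: phi_def)

lemma openin_phi: "c \<in> carrier A \<Longrightarrow> openin (point_topology A P) (phi A P c)"
  by (simp add: openin_space)

lemma character_mono:
  assumes "z \<in> P" "a \<in> carrier A" "b \<in> carrier A" "a \<sqsubseteq> b" "fst z a"
  shows "fst z b"
proof -
  have "a = a \<sqinter> b"
    using assms le_iff_join by blast
  then show ?thesis
    using assms frame_character_simps(2)[OF character[OF assms(1)]] by metis
qed

text \<open>Characters are monotone and successors reject \<open>low z\<close>, hence everything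
  below it; the converse is condition (D). So \<open>low z\<close> is determined by the successors
  of \<open>z\<close>.\<close>

lemma le_low_iff:
  assumes "z \<in> P" "c \<in> carrier A"
  shows "c \<sqsubseteq> low z \<longleftrightarrow> (\<forall>w. (z, w) \<in> R \<longrightarrow> \<not> fst w c)"
proof
  assume le: "c \<sqsubseteq> low z"
  show "\<forall>w. (z, w) \<in> R \<longrightarrow> \<not> fst w c"
    using rel_low rel_points character_mono[OF _ assms(2) low_closed[OF assms(1)] le] by blast
qed (use assms ex_rel_dia in blast)

text \<open>Otherwise \<open>dia A c\<close> lies below \<open>dia A (low z)\<close>, which
  \<open>z\<close> rejects by condition (i).\<close>

lemma not_low_if_dia:
  assumes z: "z \<in> P" and c: "c \<in> carrier A" and "fst z (dia A c)"
  shows "\<not> c \<sqsubseteq> low z"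
  using assms not_dia_low[OF z] low_closed[OF z] dia_mono[OF c low_closed[OF z]]
    character_mono[OF z dia_closed[OF c] dia_closed[OF low_closed[OF z]]] by blast

lemma dia_rel_phi:
  assumes "c \<in> carrier A"
  shows "dia_rel space (phi A P c) = {z \<in> P. \<not> c \<sqsubseteq> low z}"
proof -
  have "z \<in> dia_rel space (phi A P c) \<longleftrightarrow> z \<in> P \<and> \<not> c \<sqsubseteq> low z" for z
    unfolding mem_dia_rel phi_apply[OF assms] using rel_points le_low_iff[OF _ assms] by simp blast
  then show ?thesis
    by blast
qed

lemma phi_frame_hom: "phi A P \<in> frame_hom A (Omega space)"
proof -
  have "phi A P \<in> carrier A \<rightarrow>\<^sub>E carrier (Omega space)"
    using openin_phi by (auto simp: phi_def)
  moreover have "phi A P \<top> = \<top>\<^bsub>Omega space\<^esub>"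
    using frame_character_simps(1)[OF character] by (auto simp: top_Omega phi_apply)
  moreover have "phi A P (a \<sqinter> b) = phi A P a \<sqinter>\<^bsub>Omega space\<^esub> phi A P b"
    if "a \<in> carrier A" "b \<in> carrier A" for a b
  proof -
    have "phi A P a \<sqinter>\<^bsub>Omega space\<^esub> phi A P b = phi A P a \<inter> phi A P b"
      using that by (intro meet_Omega) (auto simp: openin_phi)
    then show ?thesis
      using that frame_character_simps(2)[OF character that(1,2)] by (auto simp: phi_apply)
  qed
  moreover have "phi A P (\<Squnion>S) = \<Squnion>\<^bsub>Omega space\<^esub> (phi A P ` S)" if S: "S \<subseteq> carrier A" for S
  proof -
    have "phi A P ` S \<subseteq> carrier (Omega space)"
      using S openin_phi by auto
    moreover have "phi A P ` S = (\<lambda>c. {z \<in> P. fst z c}) ` S"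
      using S by (auto simp: phi_apply intro!: image_cong)
    ultimately have "\<Squnion>\<^bsub>Omega space\<^esub> (phi A P ` S) = (\<Union>c\<in>S. {z \<in> P. fst z c})"
      by (simp add: sup_Omega)
    moreover have "phi A P (\<Squnion>S) = {z \<in> P. \<exists>c\<in>S. fst z c}"
      unfolding phi_apply[OF sup_closed[OF S]]
      using frame_character_simps(3)[OF character S] by blast
    ultimately show ?thesis
      by auto
  qed
  ultimately show ?thesis
    by (auto simp: frame_hom_def)
qed

text \<open>The sets \<open>phi A P (box A c)\<close> and \<open>phi A P (dia A c)\<close> are open,
  so it suffices to compare them with \<open>box_rel\<close> and \<open>dia_rel\<close> before
  taking interiors. There \<open>rel_box\<close> and condition (i) with (D) apply.\<close>

lemma phi_modal_frame_hom: "phi A P \<in> modal_frame_hom A (Omega space)"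
proof -
  have "phi A P (box A c) \<subseteq> opens space interior_of box_rel space (phi A P c)"
    if c: "c \<in> carrier A" for c
    using c rel_points rel_box[OF _ c] box_closed[OF c] openin_phi[OF box_closed[OF c]]
    by (intro interior_of_maximal) (auto simp: phi_apply box_rel_def)
  moreover have "phi A P (dia A c) \<subseteq> opens space interior_of dia_rel space (phi A P c)"
    if c: "c \<in> carrier A" for c
    unfolding dia_rel_phi[OF c]
    using openin_phi[OF dia_closed[OF c]] not_low_if_dia[OF _ c]
    by (intro interior_of_maximal) (auto simp: phi_apply dia_closed c)
  ultimately show ?thesis
    using phi_frame_hom by (auto simp: modal_frame_hom_def)
qed

text \<open>Condition (ii) is the converse of \<open>not_low_if_dia\<close>. With it
  \<open>dia_rel\<close> of \<open>phi A P c\<close> equals the open set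
  \<open>phi A P (dia A c)\<close>, and every open set of the space has the form
  \<open>phi A P c\<close>.\<close>

lemma
  assumes ii: "\<And>z. z \<in> P \<Longrightarrow> pre_ii A (fst z) (low z)"
  shows lsc_space: "lsc space" and phi_dia_strict: "dia_strict A (Omega space) (phi A P)"
proof -
  have eq: "dia_rel space (phi A P c) = phi A P (dia A c)" if c: "c \<in> carrier A" for c
    unfolding dia_rel_phi[OF c] phi_apply[OF dia_closed[OF c]]
    using ii c not_low_if_dia[OF _ c] unfolding pre_ii_def by blast
  then show "lsc space"
    using openin_phi dia_closed by (auto simp: lsc_def openin_space)
  show "dia_strict A (Omega space) (phi A P)"
    using eq openin_phi dia_closed by (auto simp: dia_strict_def interior_of_openin)
qed

end

text \<open>The version for triples: \<open>ex_rel_up\<close> is condition (B) and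
  \<open>box_up\<close> is condition (iii).\<close>

locale point_space_q = point_space A P R low
  for A :: "'a mframe" (structure)
    and P :: "(('a \<Rightarrow> bool) \<times> 'r) set" and R low +
  fixes up :: "('a \<Rightarrow> bool) \<times> 'r \<Rightarrow> 'a set"
  assumes up_closed: "z \<in> P \<Longrightarrow> up z \<subseteq> carrier A"
    and rel_up: "\<lbrakk>(z, w) \<in> R; c \<in> up z\<rbrakk> \<Longrightarrow> fst w c"
    and ex_rel_up: "\<lbrakk>z \<in> P; c \<in> carrier A; c \<notin> up z\<rbrakk> \<Longrightarrow> \<exists>w. (z, w) \<in> R \<and> \<not> fst w c"
    and box_up: "\<lbrakk>z \<in> P; c \<in> carrier A; fst z (box A c)\<rbrakk> \<Longrightarrow> c \<in> up z"
begin

lemma in_up_iff: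
  "\<lbrakk>z \<in> P; c \<in> carrier A\<rbrakk> \<Longrightarrow> c \<in> up z \<longleftrightarrow> (\<forall>w. (z, w) \<in> R \<longrightarrow> fst w c)"
  using rel_up ex_rel_up by blast

lemma box_rel_phi:
  assumes "c \<in> carrier A"
  shows "box_rel space (phi A P c) = {z \<in> P. c \<in> up z}"
proof -
  have "z \<in> box_rel space (phi A P c) \<longleftrightarrow> z \<in> P \<and> c \<in> up z" for z
    unfolding mem_box_rel phi_apply[OF assms] using rel_points in_up_iff[OF _ assms] by simp blast
  then show ?thesis
    by blast
qed

text \<open>Condition (iv) is the converse of \<open>box_up\<close>, so \<open>box_rel\<close> of
  \<open>phi A P c\<close> is the open set \<open>phi A P (box A c)\<close>.\<close>

lemma
  assumes iv: "\<And>z. z \<in> P \<Longrightarrow> pre_iv A (fst z) (up z)"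
  shows usc_space: "usc space" and phi_box_strict: "box_strict A (Omega space) (phi A P)"
proof -
  have eq: "box_rel space (phi A P c) = phi A P (box A c)" if c: "c \<in> carrier A" for c
    unfolding box_rel_phi[OF c] phi_apply[OF box_closed[OF c]]
    using iv c box_up unfolding pre_iv_def box_preimage_def by blast
  then show "usc space"
    using openin_phi box_closed by (auto simp: usc_def openin_space)
  show "box_strict A (Omega space) (phi A P)"
    using eq openin_phi box_closed by (auto simp: box_strict_def interior_of_openin)
qed

text \<open>The relation is brought into the form of the canonical relation of modal logic, with one
  clause for \<open>box\<close> and one for \<open>dia\<close>. The frame axioms, read at
  characters, then give the three properties of an equivalence.\<close>

lemma equiv_rel:
  assumes eqf: "equivalence_frame A"
    and ii: "\<And>z. z \<in> P \<Longrightarrow> pre_ii A (fst z) (low z)"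
    and R: "\<And>z w. (z, w) \<in> R \<longleftrightarrow> z \<in> P \<and> w \<in> P \<and> \<not> fst w (low z) \<and>
      (\<forall>c\<in>carrier A. fst z (box A c) \<longrightarrow> fst w c)"
  shows "equiv P R"
proof -
  interpret equivalence_frame A by fact
  note closed = box_closed dia_closed
  \<comment> \<open>By (i) and (ii), \<open>low z\<close> is the largest element whose diamond
    \<open>z\<close> rejects.\<close>
  have low_iff: "\<not> fst w (low z) \<longleftrightarrow> (\<forall>c\<in>carrier A. fst w c \<longrightarrow> fst z (dia A c))"
    if z: "z \<in> P" and w: "w \<in> P" for z w
    using ii[OF z] not_dia_low[OF z] low_closed[OF z] character_mono[OF w _ low_closed[OF z]]
    unfolding pre_ii_def by blast
  have R': "(z, w) \<in> R \<longleftrightarrow> z \<in> P \<and> w \<in> P \<and> (\<forall>c\<in>carrier A. fst w c \<longrightarrow> fst z (dia A c)) \<and>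
      (\<forall>c\<in>carrier A. fst z (box A c) \<longrightarrow> fst w c)" for z w
    unfolding R using low_iff by blast
  have T: "fst z (box A c) \<Longrightarrow> fst z c" "fst z c \<Longrightarrow> fst z (dia A c)"
    and four: "fst z (box A c) \<Longrightarrow> fst z (box A (box A c))"
      "fst z (dia A (dia A c)) \<Longrightarrow> fst z (dia A c)"
    and B: "fst z (dia A (box A c)) \<Longrightarrow> fst z c" "fst z c \<Longrightarrow> fst z (box A (dia A c))"
    if "z \<in> P" "c \<in> carrier A" for z c
  proof -
    note [simp] = closed that(2) and mono = character_mono[OF that(1)]
    show "fst z (box A c) \<Longrightarrow> fst z c" by (rule mono[OF _ _ box_T]) auto
    show "fst z c \<Longrightarrow> fst z (dia A c)" by (rule mono[OF _ _ dia_T]) auto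
    show "fst z (box A c) \<Longrightarrow> fst z (box A (box A c))" by (rule mono[OF _ _ box_4]) auto
    show "fst z (dia A (dia A c)) \<Longrightarrow> fst z (dia A c)" by (rule mono[OF _ _ dia_4]) auto
    show "fst z (dia A (box A c)) \<Longrightarrow> fst z c" by (rule mono[OF _ _ dia_box]) auto
    show "fst z c \<Longrightarrow> fst z (box A (dia A c))" by (rule mono[OF _ _ box_dia_B]) auto
  qed
  have "refl_on P R"
    unfolding refl_on_def R' using T by blast
  moreover have "sym R"
  proof (rule symI)
    fix z w assume "(z, w) \<in> R"
    then have zw: "z \<in> P" "w \<in> P" "\<And>c. c \<in> carrier A \<Longrightarrow> fst w c \<Longrightarrow> fst z (dia A c)"
        "\<And>c. c \<in> carrier A \<Longrightarrow> fst z (box A c) \<Longrightarrow> fst w c"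
      unfolding R' by blast+
    \<comment> \<open>Each clause of the converse pair comes from the other clause of the given
      pair: the diamond clause at \<open>box A c\<close> with \<open>dia_box\<close>, and the box
      clause at \<open>dia A c\<close> with \<open>box_dia_B\<close>.\<close>
    have "fst z (dia A (box A c))" if "c \<in> carrier A" "fst w (box A c)" for c
      using zw(3)[OF closed(1)] that by blast
    then have "fst z c" if "c \<in> carrier A" "fst w (box A c)" for c
      using B(1)[OF zw(1)] that by blast
    moreover have "fst w (dia A c)" if "c \<in> carrier A" "fst z c" for c
      using zw(4)[OF closed(2)] B(2)[OF zw(1)] that by blast
    ultimately show "(w, z) \<in> R"
      unfolding R' using zw(1,2) by blast
  qed
  moreover have "trans R"
  proof (rule transI)
    fix u v w assume "(u, v) \<in> R" "(v, w) \<in> R"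
    then have P: "u \<in> P" "w \<in> P"
      and uv: "\<And>c. c \<in> carrier A \<Longrightarrow> fst v c \<Longrightarrow> fst u (dia A c)"
        "\<And>c. c \<in> carrier A \<Longrightarrow> fst u (box A c) \<Longrightarrow> fst v c"
      and vw: "\<And>c. c \<in> carrier A \<Longrightarrow> fst w c \<Longrightarrow> fst v (dia A c)"
        "\<And>c. c \<in> carrier A \<Longrightarrow> fst v (box A c) \<Longrightarrow> fst w c"
      unfolding R' by blast+
    have "fst u (dia A c)" if "c \<in> carrier A" "fst w c" for c
      using four(2)[OF P(1)] uv(1)[OF closed(2)] vw(1) that by blast
    moreover have "fst w c" if "c \<in> carrier A" "fst u (box A c)" for c
      using vw(2) uv(2)[OF closed(1)] four(1)[OF P(1)] that by blast
    ultimately show "(u, w) \<in> R"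
      unfolding R' using P by blast
  qed
  ultimately show ?thesis
    using rel_points by (auto simp: equiv_def)
qed

end


section \<open>Transposition\<close>

text \<open>The restriction to the carrier makes it extensional, as elements of
  \<open>frame_hom\<close> have to be.\<close>

definition char_at :: "'a mframe \<Rightarrow> ('a \<Rightarrow> 'x set) \<Rightarrow> 'x \<Rightarrow> 'a \<Rightarrow> bool" where
  "char_at A f x = (\<lambda>c\<in>carrier A. x \<in> f c)"

definition avoided :: "'a mframe \<Rightarrow> 'x relspace \<Rightarrow> ('a \<Rightarrow> 'x set) \<Rightarrow> 'x \<Rightarrow> 'a" where
  "avoided A X f x = \<Squnion>\<^bsub>A\<^esub> {c \<in> carrier A. rel X `` {x} \<inter> f c = {}}"

definition forced :: "'a mframe \<Rightarrow> 'x relspace \<Rightarrow> ('a \<Rightarrow> 'x set) \<Rightarrow> 'x \<Rightarrow> 'a set" where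
  "forced A X f x = {c \<in> carrier A. rel X `` {x} \<subseteq> f c}"

locale modal_hom_to_space = modal_frame A
  for A :: "'a mframe" (structure) and X :: "'x relspace" and f +
  assumes X: "relational_space X" and hom: "f \<in> modal_frame_hom A (Omega X)"
begin

lemma frame_hom: "f \<in> frame_hom A (Omega X)"
  using hom by (simp add: modal_frame_hom_def)

lemma
  shows hom_open: "c \<in> carrier A \<Longrightarrow> openin (opens X) (f c)"
    and hom_top: "f \<top> = points X"
  using frame_hom by (auto simp: frame_hom_def top_Omega)

lemma hom_subset: "c \<in> carrier A \<Longrightarrow> f c \<subseteq> points X"
  using hom_open by (rule openin_subset)

lemma hom_meet: "\<lbrakk>a \<in> carrier A; b \<in> carrier A\<rbrakk> \<Longrightarrow> f (a \<sqinter> b) = f a \<inter> f b"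
  using frame_hom hom_open by (simp add: frame_hom_def meet_Omega)

lemma hom_sup:
  assumes "S \<subseteq> carrier A"
  shows "f (\<Squnion>S) = \<Union>(f ` S)"
proof -
  have "f ` S \<subseteq> carrier (Omega X)"
    using assms hom_open by auto
  then show ?thesis
    using assms frame_hom by (simp add: frame_hom_def sup_Omega)
qed

lemma hom_mono: "\<lbrakk>a \<in> carrier A; b \<in> carrier A; a \<sqsubseteq> b\<rbrakk> \<Longrightarrow> f a \<subseteq> f b"
  using hom_meet[of a b] by (metis inf.cobounded2 le_iff_join)

lemma hom_box: "c \<in> carrier A \<Longrightarrow> f (box A c) \<subseteq> box_rel X (f c)"
  using hom interior_of_subset[of "opens X" "box_rel X (f c)"] by (auto simp: modal_frame_hom_def)

lemma hom_dia: "c \<in> carrier A \<Longrightarrow> f (dia A c) \<subseteq> dia_rel X (f c)"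
  using hom interior_of_subset[of "opens X" "dia_rel X (f c)"] by (auto simp: modal_frame_hom_def)

lemma frame_character_char_at:
  assumes "x \<in> points X"
  shows "frame_character A (char_at A f x)"
proof -
  have "char_at A f x (\<Squnion>S) = \<Squnion>\<^bsub>two\<^esub> (char_at A f x ` S)" if S: "S \<subseteq> carrier A" for S
  proof -
    have "char_at A f x ` S = (\<lambda>c. x \<in> f c) ` S"
      using S by (auto simp: char_at_def intro!: image_cong)
    then show ?thesis
      using S by (auto simp: two_sup char_at_def hom_sup)
  qed
  moreover have "char_at A f x \<in> carrier A \<rightarrow>\<^sub>E carrier two"
    by (simp add: char_at_def two_def)
  ultimately show ?thesis
    using assms
    by (simp add: frame_character_def frame_hom_def char_at_def two_top two_meet hom_top hom_meet)
qed

lemma avoided_closed [simp]: "avoided A X f x \<in> carrier A"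
  by (auto simp: avoided_def intro!: sup_closed)

text \<open>As \<open>f\<close> turns joins into unions, the join of all elements that avoid the
  successors of \<open>x\<close> avoids them too.\<close>

lemma hom_avoided: "rel X `` {x} \<inter> f (avoided A X f x) = {}"
  unfolding avoided_def by (subst hom_sup) auto

lemma le_avoided_iff:
  assumes c: "c \<in> carrier A"
  shows "c \<sqsubseteq> avoided A X f x \<longleftrightarrow> rel X `` {x} \<inter> f c = {}"
proof
  show "rel X `` {x} \<inter> f c = {}" if "c \<sqsubseteq> avoided A X f x"
    using hom_mono[OF c avoided_closed that] hom_avoided by blast
qed (auto simp: avoided_def c intro!: sup_upper)

lemma pre_i_avoided: "pre_i A (char_at A f x) (avoided A X f x)"
  using hom_dia[OF avoided_closed] hom_avoided
  by (auto simp: pre_i_def char_at_def dia_closed dia_rel_def)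

lemma pre_iii_forced: "pre_iii A (char_at A f x) (forced A X f x)"
  using hom_box by (fastforce simp: pre_iii_def box_preimage_def char_at_def forced_def box_closed box_rel_def)

text \<open>Strictness and lower semicontinuity make \<open>f (dia A c)\<close> exactly
  \<open>dia_rel X (f c)\<close>. If \<open>x\<close> is not in it, then \<open>f c\<close> meets no
  successor of \<open>x\<close>, so \<open>c\<close> lies below
  \<open>avoided A X f x\<close>.\<close>

lemma pre_ii_avoided:
  assumes "lsc X" "dia_strict A (Omega X) f" "x \<in> points X"
  shows "pre_ii A (char_at A f x) (avoided A X f x)"
proof -
  have "f (dia A c) = dia_rel X (f c)" if "c \<in> carrier A" for c
    using assms that hom_open[OF that] by (simp add: dia_strict_def lsc_def interior_of_openin)
  then show ?thesis
    using assms(3) by (auto simp: pre_ii_def le_avoided_iff char_at_def dia_closed dia_rel_def)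
qed

lemma pre_iv_forced:
  assumes "usc X" "box_strict A (Omega X) f" "x \<in> points X"
  shows "pre_iv A (char_at A f x) (forced A X f x)"
proof -
  have "f (box A c) = box_rel X (f c)" if "c \<in> carrier A" for c
    using assms that hom_open[OF that] by (simp add: box_strict_def usc_def interior_of_openin)
  then show ?thesis
    using assms(3)
    by (auto simp: pre_iv_def forced_def char_at_def box_closed box_rel_def box_preimage_def)
qed

lemma lattice_filter_forced: "lattice_filter A (forced A X f x)"
proof -
  have "\<top> \<in> forced A X f x"
    using X by (auto simp: forced_def hom_top relational_space_def)
  moreover have "b \<in> forced A X f x" if "a \<in> forced A X f x" "b \<in> carrier A" "a \<sqsubseteq> b" for a b
    using that hom_mono[of a b] by (auto simp: forced_def)
  moreover have "a \<sqinter> b \<in> forced A X f x" if "a \<in> forced A X f x" "b \<in> forced A X f x" for a b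
    using that by (simp add: forced_def hom_meet)
  moreover have "forced A X f x \<subseteq> carrier A"
    by (auto simp: forced_def)
  ultimately show ?thesis
    unfolding lattice_filter_def by blast
qed

lemma char_at_mem_pre:
  assumes "x \<in> points X"
  shows "(char_at A f x, avoided A X f x) \<in> pre_RelSp A"
    and "(char_at A f x, avoided A X f x, forced A X f x) \<in> pre_RelSpq A"
  using frame_character_char_at[OF assms] pre_i_avoided pre_iii_forced lattice_filter_forced
  by (auto simp: pre_RelSp_def pre_RelSpq_def)

end

locale transposition =
  point_space A P R low + modal_hom_to_space A X f
  for A :: "'a mframe" (structure)
    and P :: "(('a \<Rightarrow> bool) \<times> 'r) set" and R low
    and X :: "'x relspace" and f
begin

lemma Omega_map_phi:
  assumes g: "g \<in> points X \<rightarrow> P"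
  shows "compose (carrier A) (Omega_map X space g) (phi A P) =
    (\<lambda>c\<in>carrier A. {x \<in> points X. fst (g x) c})"
  unfolding compose_def
proof (rule restrict_ext)
  fix c assume c: "c \<in> carrier A"
  then have "Omega_map X space g (phi A P c) = g -` phi A P c \<inter> points X"
    by (simp add: Omega_map_apply openin_phi)
  then show "Omega_map X space g (phi A P c) = {x \<in> points X. fst (g x) c}"
    using g c by (auto simp: phi_apply)
qed

text \<open>The triangle fixes the first component of \<open>g x\<close> and nothing else. The
  remaining components are left to the morphism conditions.\<close>

lemma factorises_iff:
  assumes g: "g \<in> points X \<rightarrow> P"
  shows "compose (carrier A) (Omega_map X space g) (phi A P) = f \<longleftrightarrow>
    (\<forall>x\<in>points X. fst (g x) = char_at A f x)" (is "?L = f \<longleftrightarrow> ?R")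
proof
  assume "?L = f"
  have "f c = {x \<in> points X. fst (g x) c}" if "c \<in> carrier A" for c
    unfolding \<open>?L = f\<close>[symmetric] using that by (simp add: Omega_map_phi[OF g])
  \<comment> \<open>Characters are extensional, so agreement on the carrier is equality.\<close>
  moreover have "fst (g x) \<in> extensional (carrier A)" if "x \<in> points X" for x
  proof -
    have "frame_character A (fst (g x))"
      using g that by (intro character) auto
    then show ?thesis
      by (simp add: frame_character_def frame_hom_def PiE_def)
  qed
  ultimately show ?R
    by (intro ballI extensionalityI[of _ "carrier A"]) (auto simp: char_at_def)
next
  assume R: ?R
  have "f \<in> extensional (carrier A)"
    using frame_hom by (simp add: frame_hom_def PiE_def)
  then show "?L = f"
  proof (rule extensionalityI[OF compose_extensional])
    fix c assume c: "c \<in> carrier A"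
    then have "fst (g x) c \<longleftrightarrow> x \<in> f c" if "x \<in> points X" for x
      using R that by (simp add: char_at_def)
    then show "?L c = f c"
      using hom_subset[OF c] c by (auto simp: Omega_map_phi[OF g])
  qed
qed

text \<open>Continuity is automatic, since the preimage of \<open>phi A P c\<close> is
  \<open>f c\<close>. Given condition (1), condition (2) amounts to \<open>avoided A X f x\<close>
  lying below \<open>low (g x)\<close>, and (1) itself gives the reverse inequality.\<close>

lemma p_morphism_transpose_iff:
  assumes g: "g \<in> points X \<rightarrow> P" "g \<in> extensional (points X)"
    and fst: "\<And>x. x \<in> points X \<Longrightarrow> fst (g x) = char_at A f x"
  shows "p_morphism X space g \<longleftrightarrow>
    (\<forall>x x'. (x, x') \<in> rel X \<longrightarrow> (g x, g x') \<in> R) \<and>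
    (\<forall>x\<in>points X. low (g x) = avoided A X f x)"
proof -
  have Rel: "\<And>x y. (x, y) \<in> rel X \<Longrightarrow> x \<in> points X \<and> y \<in> points X"
    using X by (auto simp: relational_space_def)
  have val: "fst (g x) c \<longleftrightarrow> x \<in> f c" if "c \<in> carrier A" "x \<in> points X" for x c
    using that fst by (simp add: char_at_def)
  have "continuous_map (opens X) (point_topology A P) g"
  proof -
    have "{x \<in> points X. g x \<in> phi A P c} = f c" if "c \<in> carrier A" for c
      using g val[OF that] hom_subset[OF that] unfolding phi_apply[OF that] by blast
    then show ?thesis
      using g hom_open by (auto simp: continuous_map_def openin_space)
  qed
  moreover have "(\<forall>U. openin (point_topology A P) U \<longrightarrow>
        (\<forall>x\<in>points X. \<forall>z. (g x, z) \<in> R \<and> z \<in> U \<longrightarrow> (\<exists>x'. (x, x') \<in> rel X \<and> g x' \<in> U)))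
      \<longleftrightarrow> (\<forall>x\<in>points X. low (g x) = avoided A X f x)" (is "?B \<longleftrightarrow> _")
    if hom: "\<forall>x x'. (x, x') \<in> rel X \<longrightarrow> (g x, g x') \<in> R"
  proof -
    \<comment> \<open>Open sets are the \<open>phi A P c\<close>, so (2) can be stated with elements
      \<open>c\<close> of the frame.\<close>
    have "?B \<longleftrightarrow> (\<forall>x\<in>points X. \<forall>c\<in>carrier A.
        (\<exists>z. (g x, z) \<in> R \<and> fst z c) \<longrightarrow> (\<exists>x'. (x, x') \<in> rel X \<and> x' \<in> f c))"
      (is "_ \<longleftrightarrow> ?C")
    proof -
      have g_mem: "g x \<in> phi A P c \<longleftrightarrow> x \<in> f c" if "c \<in> carrier A" "x \<in> points X" for x c
        using that val g by (auto simp: phi_apply)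
      have "z \<in> phi A P c \<longleftrightarrow> fst z c" if "c \<in> carrier A" "(g x, z) \<in> R" for x z c
        using that rel_points by (auto simp: phi_apply)
      moreover have "?B \<longleftrightarrow> (\<forall>c\<in>carrier A. \<forall>x\<in>points X.
          (\<exists>z. (g x, z) \<in> R \<and> z \<in> phi A P c) \<longrightarrow> (\<exists>x'. (x, x') \<in> rel X \<and> g x' \<in> phi A P c))"
        unfolding openin_space by blast
      ultimately show ?thesis
        using g_mem Rel by (smt (verit, best))
    qed
    \<comment> \<open>Contraposition, with both sides read through \<open>le_low_iff\<close> and
      \<open>le_avoided_iff\<close>.\<close>
    also have "\<dots> \<longleftrightarrow> (\<forall>x\<in>points X. \<forall>c\<in>carrier A.
        c \<sqsubseteq> avoided A X f x \<longrightarrow> c \<sqsubseteq> low (g x))"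
    proof -
      have "c \<sqsubseteq> low (g x) \<longleftrightarrow> (\<forall>w. (g x, w) \<in> R \<longrightarrow> \<not> fst w c)"
        if "x \<in> points X" "c \<in> carrier A" for x c
        using that g by (intro le_low_iff) auto
      moreover have "c \<sqsubseteq> avoided A X f x \<longleftrightarrow> (\<forall>x'. (x, x') \<in> rel X \<longrightarrow> x' \<notin> f c)"
        if "c \<in> carrier A" for x c
        using that by (auto simp: le_avoided_iff)
      ultimately show ?thesis
        by (smt (verit, best))
    qed
    also have "\<dots> \<longleftrightarrow> (\<forall>x\<in>points X. \<forall>c\<in>carrier A.
        c \<sqsubseteq> avoided A X f x \<longleftrightarrow> c \<sqsubseteq> low (g x))"
    proof -
      \<comment> \<open>By (1) images of successors of \<open>x\<close> are successors of
        \<open>g x\<close>, and these reject \<open>c\<close>.\<close>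
      have "c \<sqsubseteq> avoided A X f x" if "c \<sqsubseteq> low (g x)" "x \<in> points X" "c \<in> carrier A" for x c
      proof -
        have "\<not> fst (g y) c" if "(x, y) \<in> rel X" for y
          using \<open>c \<sqsubseteq> low (g x)\<close> \<open>x \<in> points X\<close> \<open>c \<in> carrier A\<close> that hom g le_low_iff by blast
        then show ?thesis
          using \<open>c \<in> carrier A\<close> val Rel by (auto simp: le_avoided_iff)
      qed
      then show ?thesis by blast
    qed
    also have "\<dots> \<longleftrightarrow> (\<forall>x\<in>points X. low (g x) = avoided A X f x)"
    proof (intro ball_cong iffI)
      fix x assume x: "x \<in> points X"
        and *: "\<forall>c\<in>carrier A. c \<sqsubseteq> avoided A X f x \<longleftrightarrow> c \<sqsubseteq> low (g x)"
      have cl: "low (g x) \<in> carrier A" "avoided A X f x \<in> carrier A"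
        using x g low_closed[of "g x"] by auto
      \<comment> \<open>Antisymmetry, after inserting each of the two elements for
        \<open>c\<close>.\<close>
      then show "low (g x) = avoided A X f x"
        using * by (intro le_antisym) auto
    next
      fix x assume "low (g x) = avoided A X f x"
      then show "\<forall>c\<in>carrier A. c \<sqsubseteq> avoided A X f x \<longleftrightarrow> c \<sqsubseteq> low (g x)"
        by simp
    qed simp
    finally show ?thesis .
  qed
  ultimately show ?thesis
    using g unfolding p_morphism_def by auto
qed

lemma p_morphism_low:
  assumes g: "p_morphism X space g" and fac: "compose (carrier A) (Omega_map X space g) (phi A P) = f"
    and x: "x \<in> points X"
  shows "fst (g x) = char_at A f x" "low (g x) = avoided A X f x"
proof -
  have maps: "g \<in> points X \<rightarrow> P" "g \<in> extensional (points X)"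
    using p_morphism_closed[OF g] g by (auto simp: p_morphism_def)
  then have char: "\<forall>x\<in>points X. fst (g x) = char_at A f x"
    using fac factorises_iff by blast
  then show "fst (g x) = char_at A f x"
    using x by blast
  show "low (g x) = avoided A X f x"
    using p_morphism_transpose_iff[OF maps] char g x by blast
qed

end

locale transposition_q =
  transposition A P R low X f + point_space_q A P R low up
  for A :: "'a mframe" (structure)
    and P :: "(('a \<Rightarrow> bool) \<times> 'r) set" and R low up
    and X :: "'x relspace" and f
begin

text \<open>The counterpart for filters of the determination of \<open>low\<close>: condition (1)
  puts \<open>up (g x)\<close> inside \<open>forced A X f x\<close>, and condition (3) for the open
  set \<open>phi A P c\<close> gives the converse.\<close>

lemma pq_morphism_up:
  assumes g: "pq_morphism X space g" and fac: "compose (carrier A) (Omega_map X space g) (phi A P) = f"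
    and x: "x \<in> points X"
  shows "up (g x) = forced A X f x"
proof -
  have g': "p_morphism X space g"
    using g by (simp add: pq_morphism_def)
  have Rel: "\<And>x y. (x, y) \<in> rel X \<Longrightarrow> x \<in> points X \<and> y \<in> points X"
    using X by (auto simp: relational_space_def)
  have gP: "y \<in> points X \<Longrightarrow> g y \<in> P" for y
    using p_morphism_closed[OF g'] by simp
  have mem: "g y \<in> phi A P c \<longleftrightarrow> y \<in> f c" if "c \<in> carrier A" "y \<in> points X" for y c
    using that gP p_morphism_low(1)[OF g' fac] by (auto simp: phi_apply char_at_def)
  have "c \<in> up (g x) \<longleftrightarrow> c \<in> forced A X f x" if c: "c \<in> carrier A" for c
  proof
    assume up: "c \<in> up (g x)"
    have "y \<in> f c" if y: "(x, y) \<in> rel X" for y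
    proof -
      have "(g x, g y) \<in> R"
        using g' y by (simp add: p_morphism_def)
      then have "g y \<in> phi A P c"
        using rel_up[OF _ up] gP Rel[OF y] by (simp add: phi_apply c)
      then show ?thesis
        using mem c Rel[OF y] by blast
    qed
    then show "c \<in> forced A X f x"
      using c by (auto simp: forced_def)
  next
    assume forced: "c \<in> forced A X f x"
    have "fst z c" if z: "(g x, z) \<in> R" for z
    proof (rule ccontr)
      assume "\<not> fst z c"
      then have "z \<notin> phi A P c"
        by (simp add: phi_apply c)
      then obtain y where "(x, y) \<in> rel X" "g y \<notin> phi A P c"
        using g x z openin_phi[OF c] unfolding pq_morphism_def
        by (auto simp del: split_paired_Ex split_paired_All)
      then show False
        using forced mem[OF c] Rel by (auto simp: forced_def)
    qed
    then show "c \<in> up (g x)"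
      using in_up_iff gP x c by blast
  qed
  moreover have "forced A X f x \<subseteq> carrier A"
    by (auto simp: forced_def)
  ultimately show ?thesis
    using up_closed[OF gP[OF x]] by blast
qed

text \<open>A successor of \<open>g x\<close> outside \<open>phi A P c\<close> shows that
  \<open>c\<close> is not in the filter of \<open>g x\<close>, which is
  \<open>forced A X f x\<close>; hence some successor of \<open>x\<close> lies outside
  \<open>f c\<close>.\<close>

lemma pq_morphismI:
  assumes g: "p_morphism X space g" and fst: "\<And>x. x \<in> points X \<Longrightarrow> fst (g x) = char_at A f x"
    and up: "\<And>x. x \<in> points X \<Longrightarrow> up (g x) = forced A X f x"
  shows "pq_morphism X space g"
proof -
  have Rel: "\<And>x y. (x, y) \<in> rel X \<Longrightarrow> x \<in> points X \<and> y \<in> points X"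
    using X by (auto simp: relational_space_def)
  have "\<exists>x'. (x, x') \<in> rel X \<and> g x' \<notin> phi A P c"
    if c: "c \<in> carrier A" and x: "x \<in> points X" and z: "(g x, z) \<in> R" "z \<notin> phi A P c" for c x z
  proof -
    have "\<not> fst z c"
      using z rel_points by (auto simp: phi_apply c)
    then have "c \<notin> forced A X f x"
      using rel_up z(1) up[OF x] by blast
    then obtain x' where x': "(x, x') \<in> rel X" "x' \<notin> f c"
      using c by (auto simp: forced_def)
    then have "\<not> fst (g x') c"
      using Rel fst c by (simp add: char_at_def)
    then show ?thesis
      using x' c by (auto simp: phi_apply)
  qed
  then show ?thesis
    using g by (auto simp: pq_morphism_def openin_space)
qed

end

section \<open>Points of a modal frame as instances of the two locales\<close>

lemma point_space_pair:
  assumes "modal_frame A" and Pre: "Pre \<subseteq> pre_RelSp A"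
  defines "P \<equiv> pair_points A Pre"
  shows "point_space A P (pair_rel A \<inter> P \<times> P) snd"
proof -
  interpret modal_frame A by fact
  have PPre: "P \<subseteq> pre_RelSp A" and sat: "pair_sat A P"
    using pair_points_largest(1,2)[of A Pre] Pre by (auto simp: P_def)
  show ?thesis
  proof
    fix z assume "z \<in> P"
    then show "frame_character A (fst z)" "snd z \<in> carrier A" "\<not> fst z (dia A (snd z))"
      using PPre by (auto simp: pre_RelSp_def pre_i_def)
    fix c assume "c \<in> carrier A" "\<not> c \<sqsubseteq>\<^bsub>A\<^esub> snd z"
    then show "\<exists>w. (z, w) \<in> pair_rel A \<inter> P \<times> P \<and> fst w c"
      using sat \<open>z \<in> P\<close> by (cases z) (fastforce simp: pair_sat_def)
  qed (auto simp: pair_rel_def)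
qed

lemma point_space_triple:
  assumes "modal_frame A" and Pre: "Pre \<subseteq> pre_RelSpq A"
  defines "P \<equiv> triple_points A Pre"
  shows "point_space_q A P (triple_rel A \<inter> P \<times> P) (fst \<circ> snd) (snd \<circ> snd)"
proof -
  interpret modal_frame A by fact
  have PPre: "P \<subseteq> pre_RelSpq A" and sat: "triple_sat A P"
    using triple_points_largest(1,2)[of A Pre] Pre by (auto simp: P_def)
  have D: "\<exists>w. (z, w) \<in> triple_rel A \<inter> P \<times> P \<and> fst w c"
    if "z \<in> P" "c \<in> carrier A" "\<not> c \<sqsubseteq>\<^bsub>A\<^esub> fst (snd z)" for z c
    using sat that unfolding triple_sat_def by (cases z) fastforce
  have B: "\<exists>w. (z, w) \<in> triple_rel A \<inter> P \<times> P \<and> \<not> fst w c"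
    if "z \<in> P" "c \<in> carrier A" "c \<notin> snd (snd z)" for z c
    using sat that unfolding triple_sat_def by (cases z) fastforce
  have filt: "c \<in> snd (snd z)" if "z \<in> P" "c \<in> carrier A" "fst z (box A c)" for z c
    using that PPre by (cases z) (auto simp: pre_RelSpq_def pre_iii_def box_preimage_def)
  have closed: "snd (snd z) \<subseteq> carrier A" if "z \<in> P" for z
    using that PPre by (cases z) (auto simp: pre_RelSpq_def lattice_filter_def)
  show ?thesis
  proof
    fix z assume "z \<in> P"
    then show "frame_character A (fst z)" "(fst \<circ> snd) z \<in> carrier A"
        "\<not> fst z (dia A ((fst \<circ> snd) z))"
      using PPre by (auto simp: pre_RelSpq_def pre_i_def)
  next
    fix z w c assume zw: "(z, w) \<in> triple_rel A \<inter> P \<times> P"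
    show "\<not> fst w ((fst \<circ> snd) z)"
      using zw by (auto simp: triple_rel_def)
    show up: "fst w c" if "c \<in> (snd \<circ> snd) z"
      using zw that by (auto simp: triple_rel_def nabla_def)
    \<comment> \<open>The relation on triples has no clause for \<open>box\<close>; it follows from
      (iii), as the filter of \<open>z\<close> contains \<open>c\<close>.\<close>
    show "fst w c" if "c \<in> carrier A" "fst z (box A c)"
      using zw filt that by (intro up) auto
  qed (use D B filt closed in auto)
qed

section \<open>Existence and uniqueness of transposes\<close>

definition pair_transpose :: "'a mframe \<Rightarrow> 'x relspace \<Rightarrow> ('a \<Rightarrow> 'x set) \<Rightarrow> 'x \<Rightarrow> 'a pair_pt" where
  "pair_transpose A X f = (\<lambda>x\<in>points X. (char_at A f x, avoided A X f x))"

definition triple_transpose :: "'a mframe \<Rightarrow> 'x relspace \<Rightarrow> ('a \<Rightarrow> 'x set) \<Rightarrow> 'x \<Rightarrow> 'a triple_pt" where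
  "triple_transpose A X f = (\<lambda>x\<in>points X. (char_at A f x, avoided A X f x, forced A X f x))"

text \<open>Existence is coinductive: the image of the candidate is a saturated set of pre-points,
  hence consists of points. Uniqueness holds because both components of \<open>g x\<close> are
  forced by \<open>p_morphism_low\<close>.\<close>

lemma ex1_pair_transpose:
  fixes X :: "'x relspace"
  assumes "modal_frame A" "relational_space X" "f \<in> modal_frame_hom A (Omega X)"
    and Pre: "Pre \<subseteq> pre_RelSp A"
    and mem: "\<And>x. x \<in> points X \<Longrightarrow> (char_at A f x, avoided A X f x) \<in> Pre"
  defines "P \<equiv> pair_points A Pre"
  shows "\<exists>!g. p_morphism X (pair_space A P) g \<and>
    compose (carrier A) (Omega_map X (pair_space A P) g) (phi A P) = f"
proof -
  let ?R = "pair_rel A \<inter> P \<times> P" and ?g = "pair_transpose A X f"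
  interpret point_space A P ?R snd
    unfolding P_def using assms(1) Pre by (rule point_space_pair)
  interpret transposition A P ?R snd X f
    by unfold_locales fact+
  have space: "pair_space A P = space"
    by (simp add: pair_space_def)
  have Rel: "\<And>x y. (x, y) \<in> rel X \<Longrightarrow> x \<in> points X \<and> y \<in> points X"
    using X by (auto simp: relational_space_def)
  have step: "(?g x, ?g y) \<in> pair_rel A" if "(x, y) \<in> rel X" for x y
  proof -
    have "y \<in> f c" if "c \<in> carrier A" "x \<in> f (box A c)" for c
      using hom_box[OF that(1)] that(2) \<open>(x, y) \<in> rel X\<close> by (auto simp: box_rel_def)
    then show ?thesis
      using Rel[OF that] that hom_avoided
      by (auto simp: pair_rel_def pair_transpose_def char_at_def box_closed)
  qed
  have sat: "pair_sat A (?g ` points X)"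
  proof -
    \<comment> \<open>If \<open>c\<close> is not below \<open>avoided A X f x\<close>, some
      successor \<open>y\<close> of \<open>x\<close> lies in \<open>f c\<close>; its image is the
      witness for (D).\<close>
    have "\<exists>y\<in>points X. (?g x, ?g y) \<in> pair_rel A \<and> char_at A f y c"
      if "x \<in> points X" "c \<in> carrier A" "\<not> c \<sqsubseteq>\<^bsub>A\<^esub> avoided A X f x" for x c
      using that step Rel by (fastforce simp: le_avoided_iff char_at_def)
    then show ?thesis
      by (fastforce simp: pair_sat_def pair_transpose_def)
  qed
  have gP: "?g ` points X \<subseteq> P"
    unfolding P_def by (rule pair_points_largest(3)[OF _ sat]) (auto simp: pair_transpose_def mem)
  then have maps: "?g \<in> points X \<rightarrow> P" "?g \<in> extensional (points X)"
    by (auto simp: pair_transpose_def)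
  have fst: "fst (?g x) = char_at A f x" "snd (?g x) = avoided A X f x" if "x \<in> points X" for x
    using that by (auto simp: pair_transpose_def)
  have "p_morphism X space ?g"
    using p_morphism_transpose_iff[OF maps fst(1)] fst step gP Rel by auto
  moreover have "compose (carrier A) (Omega_map X space ?g) (phi A P) = f"
    using factorises_iff[OF maps(1)] fst by blast
  moreover have "g = ?g"
    if "p_morphism X space g" "compose (carrier A) (Omega_map X space g) (phi A P) = f" for g
  proof (rule extensionalityI)
    show "g \<in> extensional (points X)"
      using that by (simp add: p_morphism_def)
    show "g x = ?g x" if "x \<in> points X" for x
      using p_morphism_low[OF \<open>p_morphism X space g\<close> _ that] that
      by (simp add: prod_eq_iff fst \<open>compose (carrier A) (Omega_map X space g) (phi A P) = f\<close>)
  qed (rule maps(2))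
  ultimately show ?thesis
    unfolding space by blast
qed

text \<open>The coinduction for pairs, extended by condition (B): if \<open>c\<close> is not in
  \<open>forced A X f x\<close>, a successor of \<open>x\<close> outside \<open>f c\<close> supplies
  the witness. In the uniqueness part \<open>pq_morphism_up\<close> fixes the third
  component.\<close>

lemma ex1_triple_transpose:
  fixes X :: "'x relspace"
  assumes "modal_frame A" "relational_space X" "f \<in> modal_frame_hom A (Omega X)"
    and Pre: "Pre \<subseteq> pre_RelSpq A"
    and mem: "\<And>x. x \<in> points X \<Longrightarrow> (char_at A f x, avoided A X f x, forced A X f x) \<in> Pre"
  defines "P \<equiv> triple_points A Pre"
  shows "\<exists>!g. pq_morphism X (triple_space A P) g \<and>
    compose (carrier A) (Omega_map X (triple_space A P) g) (phi A P) = f"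
proof -
  let ?R = "triple_rel A \<inter> P \<times> P" and ?g = "triple_transpose A X f"
  interpret point_space_q A P ?R "fst \<circ> snd" "snd \<circ> snd"
    unfolding P_def using assms(1) Pre by (rule point_space_triple)
  interpret transposition_q A P ?R "fst \<circ> snd" "snd \<circ> snd" X f
    by unfold_locales fact+
  have space: "triple_space A P = space"
    by (simp add: triple_space_def)
  have Rel: "\<And>x y. (x, y) \<in> rel X \<Longrightarrow> x \<in> points X \<and> y \<in> points X"
    using X by (auto simp: relational_space_def)
  have step: "(?g x, ?g y) \<in> triple_rel A" if "(x, y) \<in> rel X" for x y
    using Rel[OF that] that hom_avoided
    by (auto simp: triple_rel_def triple_transpose_def char_at_def nabla_def forced_def)
  have sat: "triple_sat A (?g ` points X)"
  proof -
    have "\<exists>y\<in>points X. (?g x, ?g y) \<in> triple_rel A \<and> char_at A f y c"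
      if "x \<in> points X" "c \<in> carrier A" "\<not> c \<sqsubseteq>\<^bsub>A\<^esub> avoided A X f x" for x c
      using that step Rel by (fastforce simp: le_avoided_iff char_at_def)
    moreover have "\<exists>y\<in>points X. (?g x, ?g y) \<in> triple_rel A \<and> \<not> char_at A f y c"
      if "x \<in> points X" "c \<in> carrier A" "c \<notin> forced A X f x" for x c
      using that step Rel by (fastforce simp: forced_def char_at_def)
    ultimately show ?thesis
      by (fastforce simp: triple_sat_def triple_transpose_def)
  qed
  have gP: "?g ` points X \<subseteq> P"
    unfolding P_def by (rule triple_points_largest(3)[OF _ sat]) (auto simp: triple_transpose_def mem)
  then have maps: "?g \<in> points X \<rightarrow> P" "?g \<in> extensional (points X)"
    by (auto simp: triple_transpose_def)
  have fst: "fst (?g x) = char_at A f x" "fst (snd (?g x)) = avoided A X f x"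
      "snd (snd (?g x)) = forced A X f x" if "x \<in> points X" for x
    using that by (auto simp: triple_transpose_def)
  have "p_morphism X space ?g"
    using p_morphism_transpose_iff[OF maps fst(1)] fst step gP Rel by auto
  then have "pq_morphism X space ?g"
    by (rule pq_morphismI) (auto simp: fst)
  moreover have "compose (carrier A) (Omega_map X space ?g) (phi A P) = f"
    using factorises_iff[OF maps(1)] fst by blast
  moreover have "g = ?g"
    if g: "pq_morphism X space g" and fac: "compose (carrier A) (Omega_map X space g) (phi A P) = f" for g
  proof (rule extensionalityI)
    have g': "p_morphism X space g"
      using g by (simp add: pq_morphism_def)
    then show "g \<in> extensional (points X)"
      by (simp add: p_morphism_def)
    show "g x = ?g x" if "x \<in> points X" for x
      using p_morphism_low[OF g' fac that] pq_morphism_up[OF g fac that] that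
      by (simp add: prod_eq_iff fst)
  qed (rule maps(2))
  ultimately show ?thesis
    unfolding space by blast
qed

section \<open>The adjunctions\<close>

text \<open>The universal property is needed at two types: for the given spaces, and for the spaces
  of points themselves, where it yields the action of \<open>F\<close> on morphisms and its functoriality.\<close>

lemma contravariant_adjunctionI:
  fixes F :: "'a mframe \<Rightarrow> 'p relspace"
  assumes Ob: "\<And>A. mframe_Ob (mframe_cat_of D) A \<Longrightarrow> relspace_Ob D (F A)"
    and unit: "\<And>A. mframe_Ob (mframe_cat_of D) A \<Longrightarrow>
      \<eta> A \<in> mframe_Hom (mframe_cat_of D) A (Omega (F A))"
    and univ: "\<And>A (X :: 'x relspace) f. \<lbrakk>mframe_Ob (mframe_cat_of D) A; relspace_Ob D X;
        f \<in> mframe_Hom (mframe_cat_of D) A (Omega X)\<rbrakk> \<Longrightarrow>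
      \<exists>!g. g \<in> relspace_Hom D X (F A) \<and> compose (carrier A) (Omega_map X (F A) g) (\<eta> A) = f"
    and univ_F: "\<And>A (X :: 'p relspace) f. \<lbrakk>mframe_Ob (mframe_cat_of D) A; relspace_Ob D X;
        f \<in> mframe_Hom (mframe_cat_of D) A (Omega X)\<rbrakk> \<Longrightarrow>
      \<exists>!g. g \<in> relspace_Hom D X (F A) \<and> compose (carrier A) (Omega_map X (F A) g) (\<eta> A) = f"
  shows "contravariant_adjunction TYPE('x) (mframe_cat_of D) D F \<eta>"
proof -
  let ?C = "mframe_cat_of D"
  let ?nat = "\<lambda>A B f g. compose (carrier A) (Omega_map (F B) (F A) g) (\<eta> A) = compose (carrier A) (\<eta> B) f"
  \<comment> \<open>\<open>Fmap A B f\<close> is the transpose of \<open>f\<close> followed by the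
    unit of \<open>B\<close>, that is, the unique map making the unit natural at
    \<open>f\<close>.\<close>
  define Fmap where "Fmap A B f = (THE g. g \<in> relspace_Hom D (F B) (F A) \<and> ?nat A B f g)" for A B :: "'a mframe" and f
  have ex1: "\<exists>!g. g \<in> relspace_Hom D (F B) (F A) \<and> ?nat A B f g"
    if "mframe_Ob ?C A" "mframe_Ob ?C B" "f \<in> mframe_Hom ?C A B" for A B :: "'a mframe" and f
  proof (rule univ_F)
    show "compose (carrier A) (\<eta> B) f \<in> mframe_Hom ?C A (Omega (F B))"
      using that unit[of B] mframe_Ob_Omega[OF Ob]
      by (intro mframe_Hom_compose) (auto intro: mframe_Ob_modal_frame)
  qed (use that Ob in auto)
  have Fmap: "Fmap A B f \<in> relspace_Hom D (F B) (F A)" "?nat A B f (Fmap A B f)"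
    if "mframe_Ob ?C A" "mframe_Ob ?C B" "f \<in> mframe_Hom ?C A B" for A B :: "'a mframe" and f
    using theI'[OF ex1[OF that]] by (auto simp: Fmap_def)
  have Fmap_eq: "Fmap A B f = g"
    if "mframe_Ob ?C A" "mframe_Ob ?C B" "f \<in> mframe_Hom ?C A B"
      "g \<in> relspace_Hom D (F B) (F A)" "?nat A B f g" for A B :: "'a mframe" and f g
    using ex1[OF that(1-3)] Fmap[OF that(1-3)] that(4,5) by blast
  have unit_closed: "\<eta> A a \<in> carrier (Omega (F A))" if "mframe_Ob ?C A" "a \<in> carrier A" for A :: "'a mframe" and a
    using mframe_Hom_modal_frame_hom[OF unit[OF that(1)]] that(2)
    by (auto simp: modal_frame_hom_def frame_hom_def)
  have "contravariant_functor ?C D F Fmap"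
    unfolding contravariant_functor_def
  proof (intro conjI allI impI; (elim conjE)?)
    fix A :: "'a mframe" assume A: "mframe_Ob ?C A"
    show "relspace_Ob D (F A)"
      using A by (rule Ob)
    show "Fmap A A (\<lambda>a\<in>carrier A. a) = (\<lambda>z\<in>points (F A). z)"
    \<comment> \<open>By uniqueness, each functor law only needs the naturality square of the
      expected map.\<close>
    proof (rule Fmap_eq[OF A A])
      show "?nat A A (\<lambda>a\<in>carrier A. a) (\<lambda>z\<in>points (F A). z)"
        unfolding Omega_map_id compose_def using unit_closed[OF A] by (auto intro!: restrict_ext)
    qed (use A Ob in \<open>auto intro: mframe_Hom_id relspace_Hom_id relspace_Ob_relational\<close>)
  next
    fix A B :: "'a mframe" and f assume "mframe_Ob ?C A" "mframe_Ob ?C B" "f \<in> mframe_Hom ?C A B"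
    then show "Fmap A B f \<in> relspace_Hom D (F B) (F A)"
      by (rule Fmap)
  next
    fix A B E :: "'a mframe" and f h
    assume A: "mframe_Ob ?C A" and B: "mframe_Ob ?C B" and E: "mframe_Ob ?C E"
      and f: "f \<in> mframe_Hom ?C A B" and h: "h \<in> mframe_Hom ?C B E"
    note Ff = Fmap[OF A B f] and Fh = Fmap[OF B E h]
    have cl: "f a \<in> carrier B" if "a \<in> carrier A" for a
      using mframe_Hom_modal_frame_hom[OF f] that by (auto simp: modal_frame_hom_def frame_hom_def)
    show "Fmap A E (compose (carrier A) h f) = compose (points (F E)) (Fmap A B f) (Fmap B E h)"
    proof (rule Fmap_eq[OF A E])
      show "compose (carrier A) h f \<in> mframe_Hom ?C A E"
        using A B E f h by (intro mframe_Hom_compose) (auto intro: mframe_Ob_modal_frame)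
      show "compose (points (F E)) (Fmap A B f) (Fmap B E h) \<in> relspace_Hom D (F E) (F A)"
        using Ff(1) Fh(1) Ob B E by (intro relspace_Hom_compose) (auto intro: relspace_Ob_relational)
      have "Omega_map (F E) (F A) (compose (points (F E)) (Fmap A B f) (Fmap B E h)) =
          compose (carrier (Omega (F A))) (Omega_map (F E) (F B) (Fmap B E h))
            (Omega_map (F B) (F A) (Fmap A B f))"
        using Ff(1) Fh(1) by (intro Omega_map_compose) (auto intro: relspace_Hom_p_morphism)
      moreover have "Omega_map (F B) (F A) (Fmap A B f) (\<eta> A a) = \<eta> B (f a)" if "a \<in> carrier A" for a
        using fun_cong[OF Ff(2), of a] that by (simp add: compose_def)
      moreover have "Omega_map (F E) (F B) (Fmap B E h) (\<eta> B b) = \<eta> E (h b)" if "b \<in> carrier B" for b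
        using fun_cong[OF Fh(2), of b] that by (simp add: compose_def)
      \<comment> \<open>The squares of \<open>f\<close> and \<open>h\<close> are pasted
        together.\<close>
      ultimately show "?nat A E (compose (carrier A) h f) (compose (points (F E)) (Fmap A B f) (Fmap B E h))"
        using unit_closed[OF A] cl by (auto simp: compose_def intro!: restrict_ext)
    qed
  qed
  then have "\<exists>Fmap. contravariant_functor ?C D F Fmap \<and>
      (\<forall>A B f. mframe_Ob ?C A \<and> mframe_Ob ?C B \<and> f \<in> mframe_Hom ?C A B \<longrightarrow> ?nat A B f (Fmap A B f))"
    using Fmap(2) by blast
  then show ?thesis
    using Ob unit univ Omega_functor unfolding contravariant_adjunction_def by blast
qed

section \<open>The seven cases\<close>

definition pre_pairs :: "relspace_cat \<Rightarrow> 'a mframe \<Rightarrow> 'a pair_pt set" where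
  "pre_pairs D A = (if D = RelSp then pre_RelSp A else pre_RelSp_l A)"

text \<open>The last branch serves \<open>RelSpq_c\<close> and \<open>EqSpq\<close>, which have the
  same pre-points. At the two categories with pairs its value is a mere default.\<close>

definition pre_triples :: "relspace_cat \<Rightarrow> 'a mframe \<Rightarrow> 'a triple_pt set" where
  "pre_triples D A = (case D of RelSpq \<Rightarrow> pre_RelSpq A | RelSpq_l \<Rightarrow> pre_RelSpq_l A
    | RelSpq_u \<Rightarrow> pre_RelSpq_u A | _ \<Rightarrow> pre_RelSpq_c A)"

lemma pre_pairs_subset: "pre_pairs D A \<subseteq> pre_RelSp A"
  by (auto simp: pre_pairs_def pre_RelSp_def pre_RelSp_l_def)

lemma pre_triples_subset: "pre_triples D A \<subseteq> pre_RelSpq A"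
  by (cases D) (auto simp: pre_triples_def pre_RelSpq_def pre_RelSpq_l_def pre_RelSpq_u_def
      pre_RelSpq_c_def)

text \<open>For \<open>RelSp_l\<close> the candidates must satisfy (ii) as well, which is where
  diamond-strictness of \<open>f\<close> enters.\<close>

lemma ex1_pair_morphism:
  fixes X :: "'x relspace"
  assumes D: "D \<in> {RelSp, RelSp_l}" and A: "mframe_Ob (mframe_cat_of D) A"
    and Ob: "relspace_Ob D X" and f: "f \<in> mframe_Hom (mframe_cat_of D) A (Omega X)"
  defines "P \<equiv> pair_points A (pre_pairs D A)"
  shows "\<exists>!g. g \<in> relspace_Hom D X (pair_space A P) \<and>
    compose (carrier A) (Omega_map X (pair_space A P) g) (phi A P) = f"
proof -
  note A' = mframe_Ob_modal_frame[OF A] and X' = relspace_Ob_relational[OF Ob]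
    and f' = mframe_Hom_modal_frame_hom[OF f]
  interpret modal_frame A by (rule A')
  interpret modal_hom_to_space A X f by unfold_locales (rule X' f')+
  have "(char_at A f x, avoided A X f x) \<in> pre_pairs D A" if x: "x \<in> points X" for x
  proof -
    have "pre_ii A (char_at A f x) (avoided A X f x)" if "D = RelSp_l"
      using that Ob f by (intro pre_ii_avoided x) auto
    then show ?thesis
      using D char_at_mem_pre(1)[OF x] by (auto simp: pre_pairs_def pre_RelSp_def pre_RelSp_l_def)
  qed
  then show ?thesis
    unfolding P_def using D ex1_pair_transpose[OF A' X' f' pre_pairs_subset, of D] by auto
qed

lemma ex1_triple_morphism:
  fixes X :: "'x relspace"
  assumes D: "D \<notin> {RelSp, RelSp_l}" and A: "mframe_Ob (mframe_cat_of D) A"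
    and Ob: "relspace_Ob D X" and f: "f \<in> mframe_Hom (mframe_cat_of D) A (Omega X)"
  defines "P \<equiv> triple_points A (pre_triples D A)"
  shows "\<exists>!g. g \<in> relspace_Hom D X (triple_space A P) \<and>
    compose (carrier A) (Omega_map X (triple_space A P) g) (phi A P) = f"
proof -
  note A' = mframe_Ob_modal_frame[OF A] and X' = relspace_Ob_relational[OF Ob]
    and f' = mframe_Hom_modal_frame_hom[OF f]
  interpret modal_frame A by (rule A')
  interpret modal_hom_to_space A X f by unfold_locales (rule X' f')+
  have "(char_at A f x, avoided A X f x, forced A X f x) \<in> pre_triples D A"
    if x: "x \<in> points X" for x
  proof -
    have "pre_ii A (char_at A f x) (avoided A X f x)" if "D \<in> {RelSpq_l, RelSpq_c, EqSpq}"
      using that Ob f by (intro pre_ii_avoided x) auto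
    moreover have "pre_iv A (char_at A f x) (forced A X f x)" if "D \<in> {RelSpq_u, RelSpq_c, EqSpq}"
      using that Ob f by (intro pre_iv_forced x) auto
    ultimately show ?thesis
      using D char_at_mem_pre(2)[OF x]
      by (cases D) (auto simp: pre_triples_def pre_RelSpq_def pre_RelSpq_l_def pre_RelSpq_u_def
        pre_RelSpq_c_def)
  qed
  then have "\<exists>!g. pq_morphism X (triple_space A P) g \<and>
      compose (carrier A) (Omega_map X (triple_space A P) g) (phi A P) = f"
    unfolding P_def by (rule ex1_triple_transpose[OF A' X' f' pre_triples_subset])
  moreover have "relspace_Hom D X (triple_space A P) = {g. pq_morphism X (triple_space A P) g}"
    using D by (cases D) auto
  ultimately show ?thesis
    by simp
qed

lemma pair_adjunction:
  assumes D: "D \<in> {RelSp, RelSp_l}"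
  defines "Pts \<equiv> \<lambda>A :: 'a mframe. pair_points A (pre_pairs D A)"
  shows "contravariant_adjunction TYPE('x) (mframe_cat_of D) D
    (\<lambda>A. pair_space A (Pts A)) (\<lambda>A. phi A (Pts A))"
proof (rule contravariant_adjunctionI)
  fix A :: "'a mframe" assume A: "mframe_Ob (mframe_cat_of D) A"
  interpret point_space A "Pts A" "pair_rel A \<inter> Pts A \<times> Pts A" snd
    unfolding Pts_def using mframe_Ob_modal_frame[OF A] pre_pairs_subset by (rule point_space_pair)
  have space: "pair_space A (Pts A) = space"
    by (simp add: pair_space_def)
  have "pre_ii A (fst z) (snd z)" if "D = RelSp_l" "z \<in> Pts A" for z
    using pair_points_largest(1)[of A "pre_pairs D A"] that
    by (auto simp: Pts_def pre_pairs_def pre_RelSp_l_def)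
  then show "relspace_Ob D (pair_space A (Pts A))"
      "phi A (Pts A) \<in> mframe_Hom (mframe_cat_of D) A (Omega (pair_space A (Pts A)))"
    unfolding space
    using D relational_space_space phi_modal_frame_hom lsc_space phi_dia_strict by auto
\<comment> \<open>One lemma settles both universal properties, since it is polymorphic in the type
  of the points of \<open>X\<close>.\<close>
qed (unfold Pts_def, (rule ex1_pair_morphism[OF D]; assumption)+)

lemma triple_adjunction:
  assumes D: "D \<notin> {RelSp, RelSp_l}"
  defines "Pts \<equiv> \<lambda>A :: 'a mframe. triple_points A (pre_triples D A)"
  shows "contravariant_adjunction TYPE('x) (mframe_cat_of D) D
    (\<lambda>A. triple_space A (Pts A)) (\<lambda>A. phi A (Pts A))"
proof (rule contravariant_adjunctionI)
  fix A :: "'a mframe" assume A: "mframe_Ob (mframe_cat_of D) A"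
  let ?R = "triple_rel A \<inter> Pts A \<times> Pts A"
  interpret point_space_q A "Pts A" ?R "fst \<circ> snd" "snd \<circ> snd"
    unfolding Pts_def using mframe_Ob_modal_frame[OF A] pre_triples_subset
    by (rule point_space_triple)
  have space: "triple_space A (Pts A) = space"
    by (simp add: triple_space_def)
  have Pts: "z \<in> pre_triples D A" if "z \<in> Pts A" for z
    using triple_points_largest(1) that by (auto simp: Pts_def)
  have ii: "pre_ii A (fst z) ((fst \<circ> snd) z)" if "D \<in> {RelSpq_l, RelSpq_c, EqSpq}" "z \<in> Pts A" for z
    using Pts that by (cases z) (auto simp: pre_triples_def pre_RelSpq_l_def pre_RelSpq_c_def)
  have iv: "pre_iv A (fst z) ((snd \<circ> snd) z)" if "D \<in> {RelSpq_u, RelSpq_c, EqSpq}" "z \<in> Pts A" for z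
    using Pts that by (cases z) (auto simp: pre_triples_def pre_RelSpq_u_def pre_RelSpq_c_def)
  have equiv: "equiv (Pts A) ?R" if "D = EqSpq"
  proof (rule equiv_rel)
    show "equivalence_frame A"
      using A that by simp
    fix z w
    \<comment> \<open>By (iii) and (iv) the filter of \<open>z\<close> is
      \<open>box_preimage A (fst z)\<close>, so the filter clause of the relation turns into the
      clause for \<open>box\<close>.\<close>
    show "(z, w) \<in> ?R \<longleftrightarrow> z \<in> Pts A \<and> w \<in> Pts A \<and> \<not> fst w ((fst \<circ> snd) z) \<and>
        (\<forall>c\<in>carrier A. fst z (box A c) \<longrightarrow> fst w c)"
      using iv[of z] up_closed[of z] box_up[of z] that
      by (cases z; cases w) (auto simp: triple_rel_def pre_iv_def box_preimage_def nabla_def)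
  qed (use ii that in auto)
  show "relspace_Ob D (triple_space A (Pts A))"
    unfolding space using D relational_space_space ii iv lsc_space usc_space equiv
    by (cases D) auto
  show "phi A (Pts A) \<in> mframe_Hom (mframe_cat_of D) A (Omega (triple_space A (Pts A)))"
    unfolding space using D phi_modal_frame_hom ii iv phi_dia_strict phi_box_strict
    by (cases D) auto
qed (unfold Pts_def, (rule ex1_triple_morphism[OF D]; assumption)+)

theorem theorem1:
  shows
    "contravariant_adjunction TYPE('x) MFrm RelSp
       (\<lambda>A :: 'a mframe. pair_space A (pts_RelSp A)) (\<lambda>A. phi A (pts_RelSp A)) \<and>
     contravariant_adjunction TYPE('x) MFrm_dia RelSp_l
       (\<lambda>A :: 'a mframe. pair_space A (pts_RelSp_l A)) (\<lambda>A. phi A (pts_RelSp_l A)) \<and>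
     contravariant_adjunction TYPE('x) MFrm RelSpq
       (\<lambda>A :: 'a mframe. triple_space A (pts_RelSpq A)) (\<lambda>A. phi A (pts_RelSpq A)) \<and>
     contravariant_adjunction TYPE('x) MFrm_dia RelSpq_l
       (\<lambda>A :: 'a mframe. triple_space A (pts_RelSpq_l A)) (\<lambda>A. phi A (pts_RelSpq_l A)) \<and>
     contravariant_adjunction TYPE('x) MFrm_box RelSpq_u
       (\<lambda>A :: 'a mframe. triple_space A (pts_RelSpq_u A)) (\<lambda>A. phi A (pts_RelSpq_u A)) \<and>
     contravariant_adjunction TYPE('x) MFrm_boxdia RelSpq_c
       (\<lambda>A :: 'a mframe. triple_space A (pts_RelSpq_c A)) (\<lambda>A. phi A (pts_RelSpq_c A)) \<and>
     contravariant_adjunction TYPE('x) EqFrm EqSpq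
       (\<lambda>A :: 'a mframe. triple_space A (pts_RelSpq_c A)) (\<lambda>A. phi A (pts_RelSpq_c A))"
  using pair_adjunction[of RelSp] pair_adjunction[of RelSp_l]
    triple_adjunction[of RelSpq] triple_adjunction[of RelSpq_l] triple_adjunction[of RelSpq_u]
    triple_adjunction[of RelSpq_c] triple_adjunction[of EqSpq]
  by (simp add: pts_RelSp_def pts_RelSp_l_def pts_RelSpq_def pts_RelSpq_l_def pts_RelSpq_u_def
      pts_RelSpq_c_def pre_pairs_def pre_triples_def)

end
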